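(* The model checking problem of $\mathrm{LTL}(\sim)$ is logspace-reducible to $\mathbf{\Delta^3_0}$.
   Context: Let $\mathrm{AP}$ be a countably infinite set of atomic propositions. A trace is an infinite sequence $t=t(0)t(1)\cdots\in(\wp\mathrm{AP})^\omega$, and $t^i=t(i)t(i+1)\cdots$. A team is a (possibly empty) set $T$ of traces, and $T^i=\{t^i: t\in T\}$. Formulas of $\mathrm{LTL}(\sim)$ are given by $\varphi::=p\mid\neg\varphi\mid\varphi\wedge\varphi\mid\varphi\vee\varphi\mid\mathsf X\varphi\mid\mathsf F\varphi\mid\mathsf G\varphi\mid\varphi\,\mathsf U\,\varphi\mid\varphi\,\mathsf R\,\varphi\mid{\sim}\varphi$ with $p\in\mathrm{AP}$. Synchronous team semantics: $T\models p$ iff $p\in t(0)$ for all $t\in T$; $T\models\neg\varphi$ iff $\{t\}\not\models\varphi$ for all $t\in T$; $T\models\varphi\wedge\psi$ iff $T\models\varphi$ and $T\models\psi$; $T\models\varphi\vee\psi$ iff $T=S\cup U$ for some $S,U$ with $S\models\varphi$ and $U\models\psi$; $T\models\mathsf X\varphi$ iff $T^1\models\varphi$; $T\models\mathsf F\varphi$ iff $T^k\models\varphi$ for some $k\ge0$; $T\models\mathsf G\varphi$ iff $T^k\models\varphi$ for all $k\ge0$; $T\models\varphi\,\mathsf U\,\psi$ iff there is $k\ge0$ with $T^k\models\psi$ and $T^j\models\varphi$ for all $j<k$; $T\models\varphi\,\mathsf R\,\psi$ iff for all $k\ge0$, $T^k\models\psi$ or $T^j\models\varphi$ for some $j<k$;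 $T\models{\sim}\varphi$ iff $T\not\models\varphi$. A finite Kripke structure is $K=(W,R,\eta,r)$ with $W$ finite nonempty, $R\subseteq W\times W$ serial, $\eta:W\to\wp\mathrm{AP}$ with finite labels, and root $r\in W$; a path is $\pi\in W^\omega$ with $\pi(0)=r$ and $(\pi(i),\pi(i+1))\in R$; it induces the trace $(\eta(\pi(i)))_{i\ge0}$; $T(K)$ is the team of all induced traces. Model checking: the set of pairs $(K,\varphi)$, $K$ a finite Kripke structure (encoded in binary), with $T(K)\models\varphi$. $\mathbf{\Delta^3_0}$ denotes the set of closed formulas of third-order arithmetic (vocabulary $+,\times,0,1,=,\le$; first-order variables range over $\mathbb N$, second-order variables of arity $n$ over subsets of $\mathbb N^n$, third-order variables of type $(n_1,\dots,n_k)$ over subsets of $\wp(\mathbb N^{n_1})\times\cdots\times\wp(\mathbb N^{n_k})$, with atoms $\mathfrak a(A_1,\dots,A_k)$) that are true in the standard model $\mathbb N$. *)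

theory Defs
  imports Complex_Main
begin

text \<open>Atomic propositions: AP is taken to be the countably infinite set nat.\<close>

type_synonym trace = "nat \<Rightarrow> nat set"

datatype ltl =
    LProp nat
  | LNeg ltl
  | LAnd ltl ltl
  | LOr ltl ltl
  | LX ltl
  | LF ltl
  | LG ltl
  | LU ltl ltl
  | LR ltl ltl
  | LTilde ltl

definition tsuffix :: "nat \<Rightarrow> trace set \<Rightarrow> trace set" where
  "tsuffix k T = (\<lambda>t. \<lambda>n. t (n + k)) ` T"

primrec tsat :: "ltl \<Rightarrow> trace set \<Rightarrow> bool" where
  "tsat (LProp p) T = (\<forall>t\<in>T. p \<in> t 0)"
| "tsat (LNeg \<phi>) T = (\<forall>t\<in>T. \<not> tsat \<phi> {t})"
| "tsat (LAnd \<phi> \<psi>) T = (tsat \<phi> T \<and> tsat \<psi> T)"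
| "tsat (LOr \<phi> \<psi>) T = (\<exists>S U. T = S \<union> U \<and> tsat \<phi> S \<and> tsat \<psi> U)"
| "tsat (LX \<phi>) T = tsat \<phi> (tsuffix 1 T)"
| "tsat (LF \<phi>) T = (\<exists>k. tsat \<phi> (tsuffix k T))"
| "tsat (LG \<phi>) T = (\<forall>k. tsat \<phi> (tsuffix k T))"
| "tsat (LU \<phi> \<psi>) T = (\<exists>k. tsat \<psi> (tsuffix k T) \<and> (\<forall>j<k. tsat \<phi> (tsuffix j T)))"
| "tsat (LR \<phi> \<psi>) T = (\<forall>k. tsat \<psi> (tsuffix k T) \<or> (\<exists>j<k. tsat \<phi> (tsuffix j T)))"
| "tsat (LTilde \<phi>) T = (\<not> tsat \<phi> T)"

text \<open>The set of worlds is represented as the initial segment {0..<nworlds K}.\<close>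

record kripke =
  nworlds :: nat
  rel :: "(nat \<times> nat) set"
  lab :: "nat \<Rightarrow> nat set"
  root :: nat

definition kripke_wf :: "kripke \<Rightarrow> bool" where
  "kripke_wf K \<longleftrightarrow> 0 < nworlds K
     \<and> rel K \<subseteq> {0..<nworlds K} \<times> {0..<nworlds K}
     \<and> (\<forall>w<nworlds K. \<exists>v. (w, v) \<in> rel K)
     \<and> (\<forall>w<nworlds K. finite (lab K w))
     \<and> root K < nworlds K"

definition is_path :: "kripke \<Rightarrow> (nat \<Rightarrow> nat) \<Rightarrow> bool" where
  "is_path K \<pi> \<longleftrightarrow> \<pi> 0 = root K \<and> (\<forall>i. (\<pi> i, \<pi> (Suc i)) \<in> rel K)"

definition traces :: "kripke \<Rightarrow> trace set" where
  "traces K = {(\<lambda>i. lab K (\<pi> i)) | \<pi>. is_path K \<pi>}"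

text \<open>Second-order variables are identified by (index, arity); third-order
  variables by (index, type), a type being a list of arities.\<close>

datatype aterm = AVar nat | AZero | AOne | APlus aterm aterm | ATimes aterm aterm

datatype tform =
    TEq aterm aterm
  | TLe aterm aterm
  | TIn2 nat nat "aterm list"
  | TIn3 nat "nat list" "(nat \<times> nat) list"
  | TNeg tform
  | TAnd tform tform
  | TOr tform tform
  | TEx1 nat tform
  | TAll1 nat tform
  | TEx2 nat nat tform
  | TAll2 nat nat tform
  | TEx3 nat "nat list" tform
  | TAll3 nat "nat list" tform

primrec aeval :: "(nat \<Rightarrow> nat) \<Rightarrow> aterm \<Rightarrow> nat" where
  "aeval s (AVar x) = s x"
| "aeval s AZero = 0"
| "aeval s AOne = 1"
| "aeval s (APlus a b) = aeval s a + aeval s b"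
| "aeval s (ATimes a b) = aeval s a * aeval s b"

primrec avars :: "aterm \<Rightarrow> nat set" where
  "avars (AVar x) = {x}"
| "avars AZero = {}"
| "avars AOne = {}"
| "avars (APlus a b) = avars a \<union> avars b"
| "avars (ATimes a b) = avars a \<union> avars b"

primrec twf :: "tform \<Rightarrow> bool" where
  "twf (TEq a b) = True"
| "twf (TLe a b) = True"
| "twf (TIn2 i n ts) = (0 < n \<and> length ts = n)"
| "twf (TIn3 i ty As) = (ty \<noteq> [] \<and> (\<forall>m\<in>set ty. 0 < m) \<and> map snd As = ty)"
| "twf (TNeg \<phi>) = twf \<phi>"
| "twf (TAnd \<phi> \<psi>) = (twf \<phi> \<and> twf \<psi>)"
| "twf (TOr \<phi> \<psi>) = (twf \<phi> \<and> twf \<psi>)"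
| "twf (TEx1 x \<phi>) = twf \<phi>"
| "twf (TAll1 x \<phi>) = twf \<phi>"
| "twf (TEx2 i n \<phi>) = (0 < n \<and> twf \<phi>)"
| "twf (TAll2 i n \<phi>) = (0 < n \<and> twf \<phi>)"
| "twf (TEx3 i ty \<phi>) = (ty \<noteq> [] \<and> (\<forall>m\<in>set ty. 0 < m) \<and> twf \<phi>)"
| "twf (TAll3 i ty \<phi>) = (ty \<noteq> [] \<and> (\<forall>m\<in>set ty. 0 < m) \<and> twf \<phi>)"

primrec fv1 :: "tform \<Rightarrow> nat set" where
  "fv1 (TEq a b) = avars a \<union> avars b"
| "fv1 (TLe a b) = avars a \<union> avars b"
| "fv1 (TIn2 i n ts) = (\<Union>t\<in>set ts. avars t)"
| "fv1 (TIn3 i ty As) = {}"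
| "fv1 (TNeg \<phi>) = fv1 \<phi>"
| "fv1 (TAnd \<phi> \<psi>) = fv1 \<phi> \<union> fv1 \<psi>"
| "fv1 (TOr \<phi> \<psi>) = fv1 \<phi> \<union> fv1 \<psi>"
| "fv1 (TEx1 x \<phi>) = fv1 \<phi> - {x}"
| "fv1 (TAll1 x \<phi>) = fv1 \<phi> - {x}"
| "fv1 (TEx2 i n \<phi>) = fv1 \<phi>"
| "fv1 (TAll2 i n \<phi>) = fv1 \<phi>"
| "fv1 (TEx3 i ty \<phi>) = fv1 \<phi>"
| "fv1 (TAll3 i ty \<phi>) = fv1 \<phi>"

primrec fv2 :: "tform \<Rightarrow> (nat \<times> nat) set" where
  "fv2 (TEq a b) = {}"
| "fv2 (TLe a b) = {}"
| "fv2 (TIn2 i n ts) = {(i, n)}"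
| "fv2 (TIn3 i ty As) = set As"
| "fv2 (TNeg \<phi>) = fv2 \<phi>"
| "fv2 (TAnd \<phi> \<psi>) = fv2 \<phi> \<union> fv2 \<psi>"
| "fv2 (TOr \<phi> \<psi>) = fv2 \<phi> \<union> fv2 \<psi>"
| "fv2 (TEx1 x \<phi>) = fv2 \<phi>"
| "fv2 (TAll1 x \<phi>) = fv2 \<phi>"
| "fv2 (TEx2 i n \<phi>) = fv2 \<phi> - {(i, n)}"
| "fv2 (TAll2 i n \<phi>) = fv2 \<phi> - {(i, n)}"
| "fv2 (TEx3 i ty \<phi>) = fv2 \<phi>"
| "fv2 (TAll3 i ty \<phi>) = fv2 \<phi>"

primrec fv3 :: "tform \<Rightarrow> (nat \<times> nat list) set" where
  "fv3 (TEq a b) = {}"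
| "fv3 (TLe a b) = {}"
| "fv3 (TIn2 i n ts) = {}"
| "fv3 (TIn3 i ty As) = {(i, ty)}"
| "fv3 (TNeg \<phi>) = fv3 \<phi>"
| "fv3 (TAnd \<phi> \<psi>) = fv3 \<phi> \<union> fv3 \<psi>"
| "fv3 (TOr \<phi> \<psi>) = fv3 \<phi> \<union> fv3 \<psi>"
| "fv3 (TEx1 x \<phi>) = fv3 \<phi>"
| "fv3 (TAll1 x \<phi>) = fv3 \<phi>"
| "fv3 (TEx2 i n \<phi>) = fv3 \<phi>"
| "fv3 (TAll2 i n \<phi>) = fv3 \<phi>"
| "fv3 (TEx3 i ty \<phi>) = fv3 \<phi> - {(i, ty)}"
| "fv3 (TAll3 i ty \<phi>) = fv3 \<phi> - {(i, ty)}"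

definition closed_tform :: "tform \<Rightarrow> bool" where
  "closed_tform \<phi> \<longleftrightarrow> fv1 \<phi> = {} \<and> fv2 \<phi> = {} \<and> fv3 \<phi> = {}"

text \<open>Domains: an n-ary second-order variable ranges over subsets of N^n (tuples as
  lists of length n); a third-order variable of type (n1,...,nk) ranges over sets of
  k-tuples (A1,...,Ak) with Ai a subset of N^ni.\<close>

definition tuples :: "nat \<Rightarrow> nat list set" where
  "tuples n = {xs. length xs = n}"

definition rel_tuples :: "nat list \<Rightarrow> nat list set list set" where
  "rel_tuples ty = {As. list_all2 (\<lambda>A m. A \<subseteq> tuples m) As ty}"

primrec tsem :: "tform \<Rightarrow> (nat \<Rightarrow> nat) \<Rightarrow> (nat \<Rightarrow> nat \<Rightarrow> nat list set)
                   \<Rightarrow> (nat \<Rightarrow> nat list \<Rightarrow> nat list set list set) \<Rightarrow> bool" where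
  "tsem (TEq a b) s1 s2 s3 = (aeval s1 a = aeval s1 b)"
| "tsem (TLe a b) s1 s2 s3 = (aeval s1 a \<le> aeval s1 b)"
| "tsem (TIn2 i n ts) s1 s2 s3 = (map (aeval s1) ts \<in> s2 i n)"
| "tsem (TIn3 i ty As) s1 s2 s3 = (map (\<lambda>(j, m). s2 j m) As \<in> s3 i ty)"
| "tsem (TNeg \<phi>) s1 s2 s3 = (\<not> tsem \<phi> s1 s2 s3)"
| "tsem (TAnd \<phi> \<psi>) s1 s2 s3 = (tsem \<phi> s1 s2 s3 \<and> tsem \<psi> s1 s2 s3)"
| "tsem (TOr \<phi> \<psi>) s1 s2 s3 = (tsem \<phi> s1 s2 s3 \<or> tsem \<psi> s1 s2 s3)"
| "tsem (TEx1 x \<phi>) s1 s2 s3 = (\<exists>v::nat. tsem \<phi> (s1(x := v)) s2 s3)"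
| "tsem (TAll1 x \<phi>) s1 s2 s3 = (\<forall>v::nat. tsem \<phi> (s1(x := v)) s2 s3)"
| "tsem (TEx2 i n \<phi>) s1 s2 s3 =
     (\<exists>S \<subseteq> tuples n. tsem \<phi> s1 (s2(i := (s2 i)(n := S))) s3)"
| "tsem (TAll2 i n \<phi>) s1 s2 s3 =
     (\<forall>S \<subseteq> tuples n. tsem \<phi> s1 (s2(i := (s2 i)(n := S))) s3)"
| "tsem (TEx3 i ty \<phi>) s1 s2 s3 =
     (\<exists>\<A> \<subseteq> rel_tuples ty. tsem \<phi> s1 s2 (s3(i := (s3 i)(ty := \<A>))))"
| "tsem (TAll3 i ty \<phi>) s1 s2 s3 =
     (\<forall>\<A> \<subseteq> rel_tuples ty. tsem \<phi> s1 s2 (s3(i := (s3 i)(ty := \<A>))))"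

text \<open>Truth of a sentence in the standard model (the assignment is irrelevant
  for closed formulas; we use a fixed one).\<close>

definition true_in_N :: "tform \<Rightarrow> bool" where
  "true_in_N \<phi> \<longleftrightarrow> tsem \<phi> (\<lambda>_. 0) (\<lambda>_ _. {}) (\<lambda>_ _. {})"

datatype sym = B0 | B1 | LB | RB

fun bits :: "nat \<Rightarrow> sym list" where
  "bits n = (if n < 2 then [if n = 0 then B0 else B1]
             else bits (n div 2) @ [if n mod 2 = 0 then B0 else B1])"

definition enc_nat :: "nat \<Rightarrow> sym list" where
  "enc_nat n = LB # bits n @ [RB]"

definition enc_list :: "('x \<Rightarrow> sym list) \<Rightarrow> 'x list \<Rightarrow> sym list" where
  "enc_list f xs = LB # concat (map f xs) @ [RB]"

definition node :: "nat \<Rightarrow> sym list list \<Rightarrow> sym list" where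
  "node tag args = LB # enc_nat tag @ concat args @ [RB]"

primrec enc_ltl :: "ltl \<Rightarrow> sym list" where
  "enc_ltl (LProp p) = node 0 [enc_nat p]"
| "enc_ltl (LNeg \<phi>) = node 1 [enc_ltl \<phi>]"
| "enc_ltl (LAnd \<phi> \<psi>) = node 2 [enc_ltl \<phi>, enc_ltl \<psi>]"
| "enc_ltl (LOr \<phi> \<psi>) = node 3 [enc_ltl \<phi>, enc_ltl \<psi>]"
| "enc_ltl (LX \<phi>) = node 4 [enc_ltl \<phi>]"
| "enc_ltl (LF \<phi>) = node 5 [enc_ltl \<phi>]"
| "enc_ltl (LG \<phi>) = node 6 [enc_ltl \<phi>]"
| "enc_ltl (LU \<phi> \<psi>) = node 7 [enc_ltl \<phi>, enc_ltl \<psi>]"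
| "enc_ltl (LR \<phi> \<psi>) = node 8 [enc_ltl \<phi>, enc_ltl \<psi>]"
| "enc_ltl (LTilde \<phi>) = node 9 [enc_ltl \<phi>]"

definition enc_kripke :: "kripke \<Rightarrow> sym list" where
  "enc_kripke K = node 0
     [ enc_nat (nworlds K),
       enc_list (\<lambda>w. enc_list enc_nat (sorted_list_of_set {v. (w, v) \<in> rel K})) [0..<nworlds K],
       enc_list (\<lambda>w. enc_list enc_nat (sorted_list_of_set (lab K w))) [0..<nworlds K],
       enc_nat (root K) ]"

definition enc_instance :: "kripke \<Rightarrow> ltl \<Rightarrow> sym list" where
  "enc_instance K \<phi> = node 0 [enc_kripke K, enc_ltl \<phi>]"

primrec enc_aterm :: "aterm \<Rightarrow> sym list" where
  "enc_aterm (AVar x) = node 0 [enc_nat x]"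
| "enc_aterm AZero = node 1 []"
| "enc_aterm AOne = node 2 []"
| "enc_aterm (APlus a b) = node 3 [enc_aterm a, enc_aterm b]"
| "enc_aterm (ATimes a b) = node 4 [enc_aterm a, enc_aterm b]"

definition enc_pair :: "nat \<times> nat \<Rightarrow> sym list" where
  "enc_pair p = node 0 [enc_nat (fst p), enc_nat (snd p)]"

primrec enc_tform :: "tform \<Rightarrow> sym list" where
  "enc_tform (TEq a b) = node 0 [enc_aterm a, enc_aterm b]"
| "enc_tform (TLe a b) = node 1 [enc_aterm a, enc_aterm b]"
| "enc_tform (TIn2 i n ts) = node 2 [enc_nat i, enc_nat n, enc_list enc_aterm ts]"
| "enc_tform (TIn3 i ty As) = node 3 [enc_nat i, enc_list enc_nat ty, enc_list enc_pair As]"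
| "enc_tform (TNeg \<phi>) = node 4 [enc_tform \<phi>]"
| "enc_tform (TAnd \<phi> \<psi>) = node 5 [enc_tform \<phi>, enc_tform \<psi>]"
| "enc_tform (TOr \<phi> \<psi>) = node 6 [enc_tform \<phi>, enc_tform \<psi>]"
| "enc_tform (TEx1 x \<phi>) = node 7 [enc_nat x, enc_tform \<phi>]"
| "enc_tform (TAll1 x \<phi>) = node 8 [enc_nat x, enc_tform \<phi>]"
| "enc_tform (TEx2 i n \<phi>) = node 9 [enc_nat i, enc_nat n, enc_tform \<phi>]"
| "enc_tform (TAll2 i n \<phi>) = node 10 [enc_nat i, enc_nat n, enc_tform \<phi>]"
| "enc_tform (TEx3 i ty \<phi>) = node 11 [enc_nat i, enc_list enc_nat ty, enc_tform \<phi>]"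
| "enc_tform (TAll3 i ty \<phi>) = node 12 [enc_nat i, enc_list enc_nat ty, enc_tform \<phi>]"

definition MC_LTL_tilde :: "sym list set" where
  "MC_LTL_tilde = {enc_instance K \<phi> | K \<phi>. kripke_wf K \<and> tsat \<phi> (traces K)}"

definition Delta30 :: "sym list set" where
  "Delta30 = {enc_tform \<phi> | \<phi>. twf \<phi> \<and> closed_tform \<phi> \<and> true_in_N \<phi>}"

text \<open>A deterministic Turing transducer with a read-only two-way input tape
  (delimited by end markers), one semi-infinite work tape and a write-only
  one-way output tape. States are 0..<nstates (start 0, halting state 1);
  work symbols are 0..<nwork (blank 0). A transition maps (state, input cell,
  work symbol) to (new state, written work symbol, input move, work move,
  optional output symbol); moves are in {-1,0,1}.\<close>

datatype 'a cell = LEnd | Sym 'a | REnd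

datatype ('a, 'b) tm = TM
  (delta: "nat \<Rightarrow> 'a cell \<Rightarrow> nat \<Rightarrow> nat \<times> nat \<times> int \<times> int \<times> 'b option")
  (nstates: nat) (nwork: nat)

definition tm_valid :: "('a, 'b) tm \<Rightarrow> bool" where
  "tm_valid M \<longleftrightarrow> 2 \<le> nstates M \<and> 1 \<le> nwork M \<and>
     (\<forall>q c g. q < nstates M \<longrightarrow> g < nwork M \<longrightarrow>
        (case delta M q c g of (q', g', d1, d2, _) \<Rightarrow>
           q' < nstates M \<and> g' < nwork M \<and> d1 \<in> {-1, 0, 1} \<and> d2 \<in> {-1, 0, 1}))"

type_synonym 'b config = "nat \<times> nat \<times> (nat \<Rightarrow> nat) \<times> nat \<times> 'b list"
  (* state, input head (0 = left end marker, length x + 1 = right end marker),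
     work tape contents, work head, output written so far *)

definition input_cell :: "'a list \<Rightarrow> nat \<Rightarrow> 'a cell" where
  "input_cell x i = (if i = 0 then LEnd else if i \<le> length x then Sym (x ! (i - 1)) else REnd)"

definition tm_step :: "('a, 'b) tm \<Rightarrow> 'a list \<Rightarrow> 'b config \<Rightarrow> 'b config" where
  "tm_step M x cfg = (case cfg of (q, i, w, j, out) \<Rightarrow>
     if q = 1 then cfg else
     (case delta M q (input_cell x i) (w j) of (q', g', d1, d2, ob) \<Rightarrow>
        (q', nat (min (int (length x) + 1) (max 0 (int i + d1))), w(j := g'),
         nat (max 0 (int j + d2)), out @ (case ob of None \<Rightarrow> [] | Some b \<Rightarrow> [b]))))"

definition tm_run :: "('a, 'b) tm \<Rightarrow> 'a list \<Rightarrow> nat \<Rightarrow> 'b config" where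
  "tm_run M x t = (tm_step M x ^^ t) (0, 0, \<lambda>_. 0, 0, [])"

definition cfg_state :: "'b config \<Rightarrow> nat" where "cfg_state c = fst c"
definition cfg_workhead :: "'b config \<Rightarrow> nat" where "cfg_workhead c = fst (snd (snd (snd c)))"
definition cfg_output :: "'b config \<Rightarrow> 'b list" where "cfg_output c = snd (snd (snd (snd c)))"

definition logspace_computable :: "('a list \<Rightarrow> 'b list) \<Rightarrow> bool" where
  "logspace_computable f \<longleftrightarrow> (\<exists>M c. tm_valid M \<and> (\<forall>x. \<exists>t.
      cfg_state (tm_run M x t) = 1 \<and> cfg_output (tm_run M x t) = f x \<and>
      (\<forall>s\<le>t. real (cfg_workhead (tm_run M x s)) \<le> c * log 2 (real (length x) + 2))))"

definition logspace_reducible :: "'a list set \<Rightarrow> 'b list set \<Rightarrow> bool" where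
  "logspace_reducible A B \<longleftrightarrow>
     (\<exists>f. logspace_computable f \<and> (\<forall>x. x \<in> A \<longleftrightarrow> f x \<in> B))"

end

(* The reduction maps a word x to a third-order sentence saying: "some binary relation X is the graph
   of x; X is the encoding of a Kripke structure (R, L, N, r) followed by a formula; and the team of
   traces of (R, L, N, r) satisfies the translation of that formula".

   Well-formedness of x is checked by the sentence, not by the machine: each syntactic category is
   described by a set of segments of x that is closed under unfolding one production, and such a
   closed set contains only correct segments, by induction on their length. Since the encoding of
   third-order formulas is uniquely readable, the false conjunct for an ill-formed x keeps the output
   out of the target set, whatever garbage follows.

   The translation reuses a fixed stock of variables: a first child is evaluated on the team S1
   shifted by n1, a second child on S2 shifted by n2, and its parent quantifies these four variables.
   All nodes are padded to the same number of closing brackets, so the output can be produced by a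
   two-way finite-state transducer, and the work tape stays empty. *)

theory Submission
  imports Defs
begin

section \<open>Unique readability of the encodings\<close>

text \<open>The obstacle that shapes the output is that every opening bracket owes a closing one.
  The brackets owed by the word description are paid on the way back over \<open>x\<close>, five per
  symbol. In the translation they come as nine per node, two after a first child and four per digit
  of a proposition, amounts that need no memory of the nesting.

  A child receives an unshifted team together with a time, not the shifted team. So the operators F,
  G, U and R quantify over numbers only, the two times that U and R compare are both visible, and
  the shift is carried out in one place, at the head of the child.

  The sentence guesses the structure and does not compute it. Any guess that makes it true is itself
  a structure encoded by \<open>x\<close>, so truth of the sentence already supplies the instance
  that membership in \<open>MC_LTL_tilde\<close> asks for.\<close>

declare bits.simps [simp del]

text \<open>Horner evaluation from the most significant digit. The same fold reappears when a
  sentence rebuilds the index of a proposition digit by digit.\<close>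

definition bitval :: "sym list \<Rightarrow> nat" where
  "bitval s = foldl (\<lambda>v c. 2 * v + (if c = B1 then 1 else 0)) 0 s"

lemma bitval_bits [simp]: "bitval (bits n) = n"
proof (induction n rule: bits.induct)
  case (1 n)
  show ?case
  proof (cases "n < 2")
    case True
    then show ?thesis by (subst bits.simps) (auto simp: bitval_def)
  next
    case False
    then show ?thesis using 1
      by (subst bits.simps) (auto simp: bitval_def, presburger)
  qed
qed

lemma bits_subset: "set (bits n) \<subseteq> {B0, B1}"
proof (induction n rule: bits.induct)
  case (1 n)
  then show ?case by (subst bits.simps) auto
qed

lemma inj_bits: "bits m = bits n \<Longrightarrow> m = n"
  by (metis bitval_bits)

text \<open>Encodings are nested by plain concatenation, so injectivity must also recover where an
  encoding ends, whatever follows it.\<close>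

definition prefix_code :: "('x \<Rightarrow> sym list) \<Rightarrow> bool" where
  "prefix_code f \<longleftrightarrow> (\<forall>a b u v. f a @ u = f b @ v \<longrightarrow> a = b \<and> u = v)"

lemma prefix_codeD: "prefix_code f \<Longrightarrow> f a @ u = f b @ v \<Longrightarrow> a = b \<and> u = v"
  unfolding prefix_code_def by blast

lemma prefix_code_iff: "prefix_code f \<Longrightarrow> f a @ u = f b @ v \<longleftrightarrow> a = b \<and> u = v"
  unfolding prefix_code_def by blast

text \<open>Digit strings contain no \<open>RB\<close>, so the first \<open>RB\<close> marks the end
  of the numeral.\<close>

lemma prefix_code_enc_nat: "prefix_code enc_nat"
  unfolding prefix_code_def
proof (intro allI impI)
  fix a b u v
  assume "enc_nat a @ u = enc_nat b @ v"
  then have e: "bits a @ RB # u = bits b @ RB # v"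
    by (simp add: enc_nat_def)
  have tw: "takeWhile (\<lambda>c. c \<noteq> RB) (bits n @ RB # w) = bits n" for n w
    using bits_subset[of n] by (subst takeWhile_append2) auto
  have "bits a = bits b"
    using arg_cong[OF e, of "takeWhile (\<lambda>c. c \<noteq> RB)"] tw by simp
  with e show "a = b \<and> u = v" using inj_bits by auto
qed

lemmas enc_nat_append_iff [simp] = prefix_code_iff[OF prefix_code_enc_nat]

lemma node_append_iff [simp]:
  "node t as @ u = node t' bs @ v \<longleftrightarrow> t = t' \<and> concat as @ RB # u = concat bs @ RB # v"
  by (simp add: node_def)

text \<open>Items open with \<open>LB\<close> and the list closes with \<open>RB\<close>, so the
  next symbol tells whether another item follows.\<close>

lemma prefix_code_enc_list:
  assumes f: "prefix_code f" and hd: "\<And>a. \<exists>s. f a = LB # s"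
  shows "prefix_code (enc_list f)"
  unfolding prefix_code_def
proof (intro allI impI)
  fix xs ys u v
  assume "enc_list f xs @ u = enc_list f ys @ v"
  then have "concat (map f xs) @ RB # u = concat (map f ys) @ RB # v"
    by (simp add: enc_list_def)
  then show "xs = ys \<and> u = v"
  proof (induction xs arbitrary: ys)
    case Nil
    then show ?case using hd by (cases ys) (auto, (metis append_Cons list.inject sym.distinct)+)
  next
    case (Cons a xs)
    show ?case
    proof (cases ys)
      case Nil
      then show ?thesis using Cons.prems hd[of a] by auto
    next
      case (Cons b ys')
      then have "f a @ concat (map f xs) @ RB # u = f b @ concat (map f ys') @ RB # v"
        using Cons.prems by simp
      then have "a = b" "concat (map f xs) @ RB # u = concat (map f ys') @ RB # v"
        using prefix_codeD[OF f] by blast+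
      then show ?thesis using Cons.IH Cons by auto
    qed
  qed
qed

lemma prefix_code_enc_aterm: "prefix_code enc_aterm"
proof -
  have "enc_aterm a @ u = enc_aterm b @ v \<Longrightarrow> a = b \<and> u = v" for a b u v
  proof (induction a arbitrary: b u v)
    case (APlus a1 a2)
    from APlus.prems show ?case
      by (cases b) (auto dest!: APlus.IH)
  next
    case (ATimes a1 a2)
    from ATimes.prems show ?case
      by (cases b) (auto dest!: ATimes.IH)
  next
    case (AVar x)
    then show ?case by (cases b) auto
  next
    case AZero
    then show ?case by (cases b) auto
  next
    case AOne
    then show ?case by (cases b) auto
  qed
  then show ?thesis unfolding prefix_code_def by blast
qed

lemma prefix_code_enc_pair: "prefix_code enc_pair"
  unfolding prefix_code_def by (auto simp: enc_pair_def)

lemma enc_nat_LB: "\<exists>s. enc_nat n = LB # s"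
  by (simp add: enc_nat_def)

lemma enc_aterm_LB: "\<exists>s. enc_aterm a = LB # s"
  by (cases a) (auto simp: node_def)

lemma enc_pair_LB: "\<exists>s. enc_pair a = LB # s"
  by (auto simp: node_def enc_pair_def)

lemma prefix_code_enc_tform: "prefix_code enc_tform"
proof -
  note iffs [simp] = prefix_code_iff[OF prefix_code_enc_aterm]
    prefix_code_iff[OF prefix_code_enc_list[OF prefix_code_enc_aterm enc_aterm_LB]]
    prefix_code_iff[OF prefix_code_enc_list[OF prefix_code_enc_nat enc_nat_LB]]
    prefix_code_iff[OF prefix_code_enc_list[OF prefix_code_enc_pair enc_pair_LB]]
  have "enc_tform a @ u = enc_tform b @ v \<Longrightarrow> a = b \<and> u = v" for a b u v
  proof (induction a arbitrary: b u v)
    case (TNeg a)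
    from TNeg.prems show ?case by (cases b) (auto dest!: TNeg.IH)
  next
    case (TAnd a1 a2)
    from TAnd.prems show ?case by (cases b) (auto dest!: TAnd.IH)
  next
    case (TOr a1 a2)
    from TOr.prems show ?case by (cases b) (auto dest!: TOr.IH)
  next
    case (TEx1 i a)
    from TEx1.prems show ?case by (cases b) (auto dest!: TEx1.IH)
  next
    case (TAll1 i a)
    from TAll1.prems show ?case by (cases b) (auto dest!: TAll1.IH)
  next
    case (TEx2 i n a)
    from TEx2.prems show ?case by (cases b) (auto dest!: TEx2.IH)
  next
    case (TAll2 i n a)
    from TAll2.prems show ?case by (cases b) (auto dest!: TAll2.IH)
  next
    case (TEx3 i n a)
    from TEx3.prems show ?case by (cases b) (auto dest!: TEx3.IH)
  next
    case (TAll3 i n a)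
    from TAll3.prems show ?case by (cases b) (auto dest!: TAll3.IH)
  next
    case (TEq a1 a2)
    then show ?case by (cases b) auto
  next
    case (TLe a1 a2)
    then show ?case by (cases b) auto
  next
    case (TIn2 i n ts)
    then show ?case by (cases b) auto
  next
    case (TIn3 i ty As)
    then show ?case by (cases b) auto
  qed
  then show ?thesis unfolding prefix_code_def by blast
qed

section \<open>Formula contexts and the description of a word\<close>

definition TTrue :: tform where
  "TTrue = TEq AZero AZero"

definition TImp :: "tform \<Rightarrow> tform \<Rightarrow> tform" where
  "TImp \<phi> \<psi> = TOr (TNeg \<phi>) \<psi>"

definition TIff :: "tform \<Rightarrow> tform \<Rightarrow> tform" where
  "TIff \<phi> \<psi> = TAnd (TImp \<phi> \<psi>) (TImp \<psi> \<phi>)"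

definition TConj :: "tform list \<Rightarrow> tform" where
  "TConj \<phi>s = foldr TAnd \<phi>s TTrue"

definition TDisj :: "tform list \<Rightarrow> tform" where
  "TDisj \<phi>s = foldr TOr \<phi>s (TNeg TTrue)"

text \<open>Unary terms are affordable, since only symbol codes and operator tags are named this
  way.\<close>

fun anum :: "nat \<Rightarrow> aterm" where
  "anum 0 = AZero"
| "anum (Suc n) = APlus (anum n) AOne"

lemma aeval_anum [simp]: "aeval s (anum n) = n"
  by (induction n) auto

lemma avars_anum [simp]: "avars (anum n) = {}"
  by (induction n) auto

lemma tsem_connectives [simp]:
  "tsem TTrue s1 s2 s3"
  "tsem (TImp \<phi> \<psi>) s1 s2 s3 \<longleftrightarrow> (tsem \<phi> s1 s2 s3 \<longrightarrow> tsem \<psi> s1 s2 s3)"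
  "tsem (TIff \<phi> \<psi>) s1 s2 s3 \<longleftrightarrow> (tsem \<phi> s1 s2 s3 \<longleftrightarrow> tsem \<psi> s1 s2 s3)"
  "tsem (TConj []) s1 s2 s3"
  "tsem (TConj (\<phi> # \<phi>s)) s1 s2 s3 \<longleftrightarrow> tsem \<phi> s1 s2 s3 \<and> tsem (TConj \<phi>s) s1 s2 s3"
  "\<not> tsem (TDisj []) s1 s2 s3"
  "tsem (TDisj (\<phi> # \<phi>s)) s1 s2 s3 \<longleftrightarrow> tsem \<phi> s1 s2 s3 \<or> tsem (TDisj \<phi>s) s1 s2 s3"
  by (auto simp: TTrue_def TImp_def TIff_def TConj_def TDisj_def)

lemma twf_connectives [simp]:
  "twf TTrue" "twf (TImp \<phi> \<psi>) \<longleftrightarrow> twf \<phi> \<and> twf \<psi>" "twf (TIff \<phi> \<psi>) \<longleftrightarrow> twf \<phi> \<and> twf \<psi>"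
  "twf (TConj \<phi>s) \<longleftrightarrow> (\<forall>\<phi>\<in>set \<phi>s. twf \<phi>)" "twf (TDisj \<phi>s) \<longleftrightarrow> (\<forall>\<phi>\<in>set \<phi>s. twf \<phi>)"
proof -
  show "twf (TConj \<phi>s) \<longleftrightarrow> (\<forall>\<phi>\<in>set \<phi>s. twf \<phi>)"
    by (induction \<phi>s) (auto simp: TConj_def TTrue_def)
  show "twf (TDisj \<phi>s) \<longleftrightarrow> (\<forall>\<phi>\<in>set \<phi>s. twf \<phi>)"
    by (induction \<phi>s) (auto simp: TDisj_def TTrue_def)
qed (auto simp: TTrue_def TImp_def TIff_def)

lemma fv_connectives [simp]:
  "fv1 TTrue = {}" "fv1 (TImp \<phi> \<psi>) = fv1 \<phi> \<union> fv1 \<psi>" "fv1 (TIff \<phi> \<psi>) = fv1 \<phi> \<union> fv1 \<psi>"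
  "fv1 (TConj \<phi>s) = (\<Union>\<phi>\<in>set \<phi>s. fv1 \<phi>)" "fv1 (TDisj \<phi>s) = (\<Union>\<phi>\<in>set \<phi>s. fv1 \<phi>)"
  "fv2 TTrue = {}" "fv2 (TImp \<phi> \<psi>) = fv2 \<phi> \<union> fv2 \<psi>" "fv2 (TIff \<phi> \<psi>) = fv2 \<phi> \<union> fv2 \<psi>"
  "fv2 (TConj \<phi>s) = (\<Union>\<phi>\<in>set \<phi>s. fv2 \<phi>)" "fv2 (TDisj \<phi>s) = (\<Union>\<phi>\<in>set \<phi>s. fv2 \<phi>)"
  "fv3 TTrue = {}" "fv3 (TImp \<phi> \<psi>) = fv3 \<phi> \<union> fv3 \<psi>" "fv3 (TIff \<phi> \<psi>) = fv3 \<phi> \<union> fv3 \<psi>"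
  "fv3 (TConj \<phi>s) = (\<Union>\<phi>\<in>set \<phi>s. fv3 \<phi>)" "fv3 (TDisj \<phi>s) = (\<Union>\<phi>\<in>set \<phi>s. fv3 \<phi>)"
proof -
  show "fv1 (TConj \<phi>s) = (\<Union>\<phi>\<in>set \<phi>s. fv1 \<phi>)"
    "fv2 (TConj \<phi>s) = (\<Union>\<phi>\<in>set \<phi>s. fv2 \<phi>)"
    "fv3 (TConj \<phi>s) = (\<Union>\<phi>\<in>set \<phi>s. fv3 \<phi>)"
    by (induction \<phi>s) (auto simp: TConj_def TTrue_def)
  show "fv1 (TDisj \<phi>s) = (\<Union>\<phi>\<in>set \<phi>s. fv1 \<phi>)"
    "fv2 (TDisj \<phi>s) = (\<Union>\<phi>\<in>set \<phi>s. fv2 \<phi>)"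
    "fv3 (TDisj \<phi>s) = (\<Union>\<phi>\<in>set \<phi>s. fv3 \<phi>)"
    by (induction \<phi>s) (auto simp: TDisj_def TTrue_def)
qed (auto simp: TTrue_def TImp_def TIff_def)

text \<open>One-hole contexts whose hole is always the last argument. The encoding then splits into
  a prefix independent of the contents, the contents, and a single \<open>RB\<close>, which suits a
  one-way output tape.\<close>

datatype frame =
    FNeg | FAnd tform | FOr tform | FEx1 nat | FAll1 nat | FEx2 nat nat | FAll2 nat nat
  | FEx3 nat "nat list"

fun fill :: "frame \<Rightarrow> tform \<Rightarrow> tform" where
  "fill FNeg \<phi> = TNeg \<phi>"
| "fill (FAnd \<psi>) \<phi> = TAnd \<psi> \<phi>"
| "fill (FOr \<psi>) \<phi> = TOr \<psi> \<phi>"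
| "fill (FEx1 x) \<phi> = TEx1 x \<phi>"
| "fill (FAll1 x) \<phi> = TAll1 x \<phi>"
| "fill (FEx2 i n) \<phi> = TEx2 i n \<phi>"
| "fill (FAll2 i n) \<phi> = TAll2 i n \<phi>"
| "fill (FEx3 i ty) \<phi> = TEx3 i ty \<phi>"

fun frame_prefix :: "frame \<Rightarrow> sym list" where
  "frame_prefix FNeg = LB # enc_nat 4"
| "frame_prefix (FAnd \<psi>) = LB # enc_nat 5 @ enc_tform \<psi>"
| "frame_prefix (FOr \<psi>) = LB # enc_nat 6 @ enc_tform \<psi>"
| "frame_prefix (FEx1 x) = LB # enc_nat 7 @ enc_nat x"
| "frame_prefix (FAll1 x) = LB # enc_nat 8 @ enc_nat x"
| "frame_prefix (FEx2 i n) = LB # enc_nat 9 @ enc_nat i @ enc_nat n"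
| "frame_prefix (FAll2 i n) = LB # enc_nat 10 @ enc_nat i @ enc_nat n"
| "frame_prefix (FEx3 i ty) = LB # enc_nat 11 @ enc_nat i @ enc_list enc_nat ty"

definition plug :: "frame list \<Rightarrow> tform \<Rightarrow> tform" where
  "plug fs \<phi> = foldr fill fs \<phi>"

definition frames_prefix :: "frame list \<Rightarrow> sym list" where
  "frames_prefix fs = concat (map frame_prefix fs)"

lemma plug_simps [simp]: "plug [] \<phi> = \<phi>" "plug (f # fs) \<phi> = fill f (plug fs \<phi>)"
  "plug (fs @ gs) \<phi> = plug fs (plug gs \<phi>)"
  by (auto simp: plug_def)

lemma frames_prefix_simps [simp]: "frames_prefix [] = []" "frames_prefix (f # fs) = frame_prefix f @ frames_prefix fs"
  "frames_prefix (fs @ gs) = frames_prefix fs @ frames_prefix gs"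
  by (auto simp: frames_prefix_def)

lemma enc_fill: "enc_tform (fill f \<phi>) = frame_prefix f @ enc_tform \<phi> @ [RB]"
  by (cases f) (auto simp: node_def)

lemma enc_plug: "enc_tform (plug fs \<phi>) = frames_prefix fs @ enc_tform \<phi> @ replicate (length fs) RB"
  by (induction fs) (auto simp: enc_fill replicate_append_same)

text \<open>The tag fixes the constructor and the remaining components are prefix codes, so a
  printed prefix leaves no choice for the outermost frame.\<close>

lemma enc_eq_frame_prefixD:
  assumes "enc_tform \<Psi> @ u = frame_prefix f @ s"
  shows "\<exists>\<phi>. \<Psi> = fill f \<phi> \<and> s = enc_tform \<phi> @ RB # u"
proof -
  note [simp] = prefix_code_iff[OF prefix_code_enc_tform]
    prefix_code_iff[OF prefix_code_enc_list[OF prefix_code_enc_nat enc_nat_LB]]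
  from assms show ?thesis
    by (cases f; cases \<Psi>) (auto simp: node_def)
qed

text \<open>Nothing is assumed about \<open>s\<close>, which for an ill-formed input is whatever the
  transducer happens to print.\<close>

lemma enc_eq_frames_prefixD:
  assumes "enc_tform \<Psi> @ u = frames_prefix fs @ s"
  shows "\<exists>\<phi>. \<Psi> = plug fs \<phi> \<and> s = enc_tform \<phi> @ replicate (length fs) RB @ u"
  using assms
proof (induction fs arbitrary: \<Psi> u)
  case Nil
  then show ?case by auto
next
  case (Cons f fs)
  then have "enc_tform \<Psi> @ u = frame_prefix f @ frames_prefix fs @ s" by simp
  from enc_eq_frame_prefixD[OF this] obtain \<phi> where
    1: "\<Psi> = fill f \<phi>" "frames_prefix fs @ s = enc_tform \<phi> @ RB # u" by blast
  from Cons.IH[of \<phi> "RB # u"] 1(2) obtain \<phi>' where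
    "\<phi> = plug fs \<phi>'" "s = enc_tform \<phi>' @ replicate (length fs) RB @ RB # u" by auto
  then show ?case using 1 by (auto simp: replicate_app_Cons_same)
qed

section \<open>Describing a word by its graph\<close>

primrec symcode :: "sym \<Rightarrow> nat" where
  "symcode B0 = 0" | "symcode B1 = 1" | "symcode LB = 2" | "symcode RB = 3"

lemma symcode_inject [simp]: "symcode a = symcode b \<longleftrightarrow> a = b"
  by (cases a; cases b) auto

text \<open>The position is held in variable 0 and advanced through variable 1, because
  requantifying 0 directly would hide the old value. No position numeral is written, so the text of
  a block depends on the symbol alone.\<close>

definition word_block :: "sym \<Rightarrow> frame list" where
  "word_block c =
     [FAnd (TAll1 2 (TIff (TIn2 0 2 [AVar 0, AVar 2]) (TEq (AVar 2) (anum (symcode c))))),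
      FEx1 1, FAnd (TEq (AVar 1) (APlus (AVar 0) AOne)), FEx1 0, FAnd (TEq (AVar 0) (AVar 1))]"

definition word_start :: "frame list" where
  "word_start = [FEx1 0, FAnd (TEq (AVar 0) AZero)]"

definition word_end :: tform where
  "word_end =
     TAll1 1 (TAll1 2 (TNeg (TAnd (TLe (AVar 0) (AVar 1)) (TIn2 0 2 [AVar 1, AVar 2]))))"

definition word_form :: "sym list \<Rightarrow> tform" where
  "word_form x = plug (word_start @ concat (map word_block x)) word_end"

lemma tsem_word_block:
  "tsem (plug (word_block c) \<phi>) s1 s2 s3 \<longleftrightarrow>
   (\<forall>s. [s1 0, s] \<in> s2 0 2 \<longleftrightarrow> s = symcode c) \<and>
   tsem \<phi> (s1(1 := Suc (s1 0), 0 := Suc (s1 0))) s2 s3"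
  by (simp add: word_block_def)

lemma tsem_word_blocks:
  "tsem (plug (concat (map word_block x)) word_end) s1 s2 s3 \<longleftrightarrow>
   (\<forall>i s. [s1 0 + i, s] \<in> s2 0 2 \<longleftrightarrow> i < length x \<and> s = symcode (x ! i))"
proof (induction x arbitrary: s1)
  case Nil
  show ?case by (auto simp: word_end_def) (metis le_add_diff_inverse)
next
  case (Cons c x)
  let ?Q = "\<lambda>i. \<forall>s. [s1 0 + i, s] \<in> s2 0 2 \<longleftrightarrow> i < length (c # x) \<and> s = symcode ((c # x) ! i)"
  have "(\<forall>i. ?Q i) \<longleftrightarrow> ?Q 0 \<and> (\<forall>i. ?Q (Suc i))"
    by (metis not0_implies_Suc)
  then show ?case
    by (simp add: tsem_word_block Cons.IH)
qed

definition graph_of :: "sym list \<Rightarrow> nat list set" where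
  "graph_of x = {[i, symcode (x ! i)] | i. i < length x}"

text \<open>The formula speaks about pairs only; it determines the whole set because lists of other
  lengths are excluded by the hypothesis.\<close>

lemma tsem_word_form:
  assumes "s2 0 2 \<subseteq> tuples 2"
  shows "tsem (word_form x) s1 s2 s3 \<longleftrightarrow> s2 0 2 = graph_of x"
proof -
  have "tsem (word_form x) s1 s2 s3 \<longleftrightarrow>
      (\<forall>i s. [i, s] \<in> s2 0 2 \<longleftrightarrow> i < length x \<and> s = symcode (x ! i))"
    by (simp add: word_form_def word_start_def tsem_word_blocks)
  also have "\<dots> \<longleftrightarrow> s2 0 2 = graph_of x"
  proof
    assume *: "\<forall>i s. [i, s] \<in> s2 0 2 \<longleftrightarrow> i < length x \<and> s = symcode (x ! i)"
    have "l \<in> s2 0 2 \<longleftrightarrow> l \<in> graph_of x" for l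
    proof (cases "l \<in> tuples 2")
      case True
      then obtain a b where "l = [a, b]"
        by (auto simp: tuples_def numeral_2_eq_2 length_Suc_conv)
      then show ?thesis using * by (auto simp: graph_of_def)
    next
      case False
      then show ?thesis using assms by (auto simp: graph_of_def tuples_def)
    qed
    then show "s2 0 2 = graph_of x" by blast
  qed (auto simp: graph_of_def)
  finally show ?thesis .
qed

lemma twf_word_form [simp]: "twf (word_form x)"
proof -
  have "twf (plug (concat (map word_block x)) word_end)"
    by (induction x) (auto simp: word_block_def word_end_def)
  then show ?thesis by (auto simp: word_form_def word_start_def)
qed

lemma fv_word_form: "fv1 (word_form x) = {}" "fv2 (word_form x) \<subseteq> {(0, 2)}" "fv3 (word_form x) = {}"
proof -
  have "fv1 (plug (concat (map word_block x)) word_end) \<subseteq> {0} \<and>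
      fv2 (plug (concat (map word_block x)) word_end) \<subseteq> {(0, 2)} \<and>
      fv3 (plug (concat (map word_block x)) word_end) = {}"
    by (induction x) (auto simp: word_block_def word_end_def)
  then show "fv1 (word_form x) = {}" "fv2 (word_form x) \<subseteq> {(0, 2)}" "fv3 (word_form x) = {}"
    by (auto simp: word_form_def word_start_def)
qed

section \<open>Well-formed instances\<close>

text \<open>Occurrence of a string between two positions, as a relation: concatenation becomes an
  existential over the middle position, which is how a sentence can express it.\<close>

primrec seg :: "sym list \<Rightarrow> nat \<Rightarrow> nat \<Rightarrow> sym list \<Rightarrow> bool" where
  "seg x i j [] \<longleftrightarrow> i = j"
| "seg x i j (c # s) \<longleftrightarrow> i < length x \<and> x ! i = c \<and> seg x (Suc i) j s"

lemma seg_append [simp]: "seg x i j (s @ t) \<longleftrightarrow> (\<exists>k. seg x i k s \<and> seg x k j t)"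
  by (induction s arbitrary: i) auto

lemma seg_drop: "seg x i j s \<Longrightarrow> drop i x = s @ drop j x"
  by (induction s arbitrary: i) (auto simp: Cons_nth_drop_Suc[symmetric])

lemma seg_refl: "seg (u @ s) (length u) (length (u @ s)) s"
proof (induction s arbitrary: u)
  case (Cons c s)
  from Cons.IH[of "u @ [c]"] show ?case by (simp add: nth_append)
qed auto

lemma seg_length: "seg x i j s \<Longrightarrow> j = i + length s"
  by (induction s arbitrary: i) fastforce+

section \<open>Closed sets of segments for numerals, rows and temporal formulas\<close>

definition char_at :: "nat list set \<Rightarrow> nat \<Rightarrow> sym \<Rightarrow> bool" where
  "char_at X i c \<longleftrightarrow> [i, symcode c] \<in> X"

definition nat_at :: "nat list set \<Rightarrow> nat list set \<Rightarrow> nat \<Rightarrow> nat \<Rightarrow> nat \<Rightarrow> bool" where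
  "nat_at X B i j v \<longleftrightarrow> char_at X i LB \<and> (\<exists>k. [Suc i, k, v] \<in> B \<and> char_at X k RB \<and> j = Suc k)"

lemma char_at_graph [simp]: "char_at (graph_of x) i c \<longleftrightarrow> i < length x \<and> x ! i = c"
  by (auto simp: char_at_def graph_of_def)

text \<open>A triple gives start, end and value of a digit string, and unfolding splits off its last
  digit. The condition \<open>1 \<le> u\<close> rules out leading zeros, which \<open>bits\<close>
  never produces.\<close>

definition bits_closed :: "nat list set \<Rightarrow> nat list set \<Rightarrow> bool" where
  "bits_closed X B \<longleftrightarrow> (\<forall>i j v. [i, j, v] \<in> B \<longrightarrow>
     v = 0 \<and> j = Suc i \<and> char_at X i B0 \<or>
     v = 1 \<and> j = Suc i \<and> char_at X i B1 \<or>
     (\<exists>u k. 1 \<le> u \<and> [i, k, u] \<in> B \<and> j = Suc k \<and>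
        (v = u + u \<and> char_at X k B0 \<or> v = Suc (u + u) \<and> char_at X k B1)))"

lemma bits_rec: "bits 0 = [B0]" "bits (Suc 0) = [B1]"
  "1 \<le> u \<Longrightarrow> bits (u + u) = bits u @ [B0]" "1 \<le> u \<Longrightarrow> bits (Suc (u + u)) = bits u @ [B1]"
proof -
  show "bits 0 = [B0]" "bits (Suc 0) = [B1]" by (subst bits.simps, simp)+
  assume u: "1 \<le> u"
  have "(u + u) div 2 = u" "Suc (u + u) div 2 = u" by auto
  moreover have "(u + u) mod 2 = 0" "Suc (u + u) mod 2 = 1" by presburger+
  ultimately show "bits (u + u) = bits u @ [B0]" "bits (Suc (u + u)) = bits u @ [B1]"
    using u by (subst bits.simps, simp)+
qed

text \<open>Here the value can serve as the measure: with \<open>1 \<le> u\<close>, both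
  \<open>u + u\<close> and \<open>Suc (u + u)\<close> exceed \<open>u\<close>.\<close>

lemma bits_closed_sound:
  assumes "bits_closed (graph_of x) B" "[i, j, v] \<in> B"
  shows "seg x i j (bits v)"
  using assms(2)
proof (induction v arbitrary: i j rule: less_induct)
  case (less v)
  note c = assms(1)[unfolded bits_closed_def, rule_format, OF less.prems]
  then consider "v = 0" "j = Suc i" "char_at (graph_of x) i B0"
    | "v = 1" "j = Suc i" "char_at (graph_of x) i B1"
    | u k where "1 \<le> u" "[i, k, u] \<in> B" "j = Suc k"
        "v = u + u \<and> char_at (graph_of x) k B0 \<or> v = Suc (u + u) \<and> char_at (graph_of x) k B1"
    by blast
  then show ?case
  proof cases
    case 3
    then have "u < v" by auto
    from less.IH[OF this 3(2)] have "seg x i k (bits u)" .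
    then show ?thesis using 3 by (auto simp: bits_rec)
  qed (auto simp: bits_rec)
qed

lemma nat_at_sound:
  assumes "bits_closed (graph_of x) B" "nat_at (graph_of x) B i j v"
  shows "seg x i j (enc_nat v)"
  using assms(2) bits_closed_sound[OF assms(1)] by (auto simp: nat_at_def enc_nat_def)

text \<open>By soundness, this is the largest closed set of triples.\<close>

definition bits_segs :: "sym list \<Rightarrow> nat list set" where
  "bits_segs x = {[i, j, v] | i j v. seg x i j (bits v)}"

lemma bits_cases:
  obtains "v = 0" | "v = 1" | u where "1 \<le> u" "v = u + u" | u where "1 \<le> u" "v = Suc (u + u)"
proof -
  have "v = 0 \<or> v = 1 \<or> 1 \<le> v div 2 \<and> (v = v div 2 + v div 2 \<or> v = Suc (v div 2 + v div 2))"
    by presburger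
  then show ?thesis using that by blast
qed

lemma bits_closed_complete: "bits_closed (graph_of x) (bits_segs x)"
  unfolding bits_closed_def
proof (intro allI impI)
  fix i j v
  assume "[i, j, v] \<in> bits_segs x"
  then have s: "seg x i j (bits v)" by (auto simp: bits_segs_def)
  show "v = 0 \<and> j = Suc i \<and> char_at (graph_of x) i B0 \<or>
     v = 1 \<and> j = Suc i \<and> char_at (graph_of x) i B1 \<or>
     (\<exists>u k. 1 \<le> u \<and> [i, k, u] \<in> bits_segs x \<and> j = Suc k \<and>
        (v = u + u \<and> char_at (graph_of x) k B0 \<or> v = Suc (u + u) \<and> char_at (graph_of x) k B1))"
  proof (cases v rule: bits_cases)
    case (3 u)
    with s obtain k where "seg x i k (bits u)" "k < length x" "x ! k = B0" "j = Suc k"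
      by (auto simp: bits_rec)
    with 3 show ?thesis
      by (intro disjI2 exI[of _ u] exI[of _ k]) (auto simp: bits_segs_def)
  next
    case (4 u)
    with s obtain k where "seg x i k (bits u)" "k < length x" "x ! k = B1" "j = Suc k"
      by (auto simp: bits_rec)
    with 4 show ?thesis
      by (intro disjI2 exI[of _ u] exI[of _ k]) (auto simp: bits_segs_def)
  qed (use s in \<open>auto simp: bits_rec\<close>)
qed

lemma nat_at_complete:
  "nat_at (graph_of x) (bits_segs x) i j v \<longleftrightarrow> seg x i j (enc_nat v)"
  by (auto simp: nat_at_def enc_nat_def bits_segs_def)

text \<open>A tuple \<open>[i, j, w, m]\<close> stands for the tail of row \<open>w\<close> that
  lists the entries from \<open>m\<close> on. Unfolding always takes the least remaining entry,
  which enforces the order of \<open>sorted_list_of_set\<close>.\<close>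

definition row_closed ::
    "nat list set \<Rightarrow> nat list set \<Rightarrow> nat list set \<Rightarrow> nat list set \<Rightarrow> bool" where
  "row_closed X B R S \<longleftrightarrow> (\<forall>i j w m. [i, j, w, m] \<in> S \<longrightarrow>
     i = j \<and> (\<forall>v. m \<le> v \<longrightarrow> [w, v] \<notin> R) \<or>
     (\<exists>v k. m \<le> v \<and> [w, v] \<in> R \<and> (\<forall>u. m \<le> u \<and> [w, u] \<in> R \<longrightarrow> v \<le> u) \<and>
        nat_at X B i k v \<and> [k, j, w, Suc v] \<in> S))"

definition enc_row :: "nat list set \<Rightarrow> nat \<Rightarrow> nat \<Rightarrow> sym list" where
  "enc_row R w m = concat (map enc_nat (sorted_list_of_set {v. m \<le> v \<and> [w, v] \<in> R}))"

lemma enc_row_empty: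
  assumes "\<forall>v. m \<le> v \<longrightarrow> [w, v] \<notin> R"
  shows "finite {v. m \<le> v \<and> [w, v] \<in> R}" "enc_row R w m = []"
proof -
  have e: "{v. m \<le> v \<and> [w, v] \<in> R} = {}" using assms by auto
  show "finite {v. m \<le> v \<and> [w, v] \<in> R}" by (simp only: e finite.emptyI)
  show "enc_row R w m = []" by (simp only: enc_row_def e) simp
qed

text \<open>\<open>sorted_list_of_set\<close> describes a set only if it is finite, so finiteness is
  passed upwards together with the equation.\<close>

lemma enc_row_least:
  assumes "m \<le> v" "[w, v] \<in> R" "\<forall>u. m \<le> u \<and> [w, u] \<in> R \<longrightarrow> v \<le> u"
    and "finite {u. Suc v \<le> u \<and> [w, u] \<in> R}"
  shows "finite {u. m \<le> u \<and> [w, u] \<in> R}" "enc_row R w m = enc_nat v @ enc_row R w (Suc v)"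
proof -
  let ?A = "{u. m \<le> u \<and> [w, u] \<in> R}"
  have A: "?A = insert v {u. Suc v \<le> u \<and> [w, u] \<in> R}"
  proof -
    have "m \<le> u \<and> [w, u] \<in> R \<longleftrightarrow> u = v \<or> Suc v \<le> u \<and> [w, u] \<in> R" for u
      using assms(1,2) assms(3)[rule_format, of u] by (cases "u = v") auto
    then show ?thesis by auto
  qed
  show fin: "finite ?A" using assms(4) by (simp add: A)
  have "Min ?A = v"
    using fin assms by (intro Min_eqI) auto
  moreover have "?A - {v} = {u. Suc v \<le> u \<and> [w, u] \<in> R}"
    unfolding A by auto
  moreover have "?A \<noteq> {}" using A by auto
  ultimately have "sorted_list_of_set ?A = v # sorted_list_of_set {u. Suc v \<le> u \<and> [w, u] \<in> R}"
    using sorted_list_of_set_nonempty[OF fin] by metis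
  then show "enc_row R w m = enc_nat v @ enc_row R w (Suc v)"
    by (simp add: enc_row_def)
qed

text \<open>Each unfolding consumes a nonempty numeral, so the rest of \<open>x\<close> shrinks. The
  same induction shows that the row is finite, which is where finiteness of the labels will come
  from.\<close>

lemma row_closed_sound:
  assumes B: "bits_closed (graph_of x) B" and S: "row_closed (graph_of x) B R S"
    and "[i, j, w, m] \<in> S"
  shows "finite {v. m \<le> v \<and> [w, v] \<in> R} \<and> seg x i j (enc_row R w m)"
  using assms(3)
proof (induction "length x - i" arbitrary: i j m rule: less_induct)
  case less
  from S[unfolded row_closed_def, rule_format, OF less.prems]
  consider "i = j" "\<forall>v. m \<le> v \<longrightarrow> [w, v] \<notin> R"
    | v k where "m \<le> v" "[w, v] \<in> R" "\<forall>u. m \<le> u \<and> [w, u] \<in> R \<longrightarrow> v \<le> u"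
        "nat_at (graph_of x) B i k v" "[k, j, w, Suc v] \<in> S"
    by blast
  then show ?case
  proof cases
    case 1
    then show ?thesis using enc_row_empty[OF 1(2)] by simp
  next
    case 2
    have s: "seg x i k (enc_nat v)" using nat_at_sound[OF B 2(4)] .
    then have "i < length x" "i < k" using seg_length[OF s] by (auto simp: enc_nat_def)
    then have "length x - k < length x - i" by auto
    from less.hyps[OF this 2(5)] s show ?thesis
      using enc_row_least[OF 2(1-3)] by auto
  qed
qed

definition row_segs :: "sym list \<Rightarrow> nat list set \<Rightarrow> nat list set" where
  "row_segs x R = {[i, j, w, m] | i j w m. seg x i j (enc_row R w m)}"

lemma row_closed_complete:
  assumes fin: "\<And>w. finite {v. [w, v] \<in> R}"
  shows "row_closed (graph_of x) (bits_segs x) R (row_segs x R)"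
  unfolding row_closed_def
proof (intro allI impI)
  fix i j w m
  assume "[i, j, w, m] \<in> row_segs x R"
  then have s: "seg x i j (enc_row R w m)" by (auto simp: row_segs_def)
  show "i = j \<and> (\<forall>v. m \<le> v \<longrightarrow> [w, v] \<notin> R) \<or>
     (\<exists>v k. m \<le> v \<and> [w, v] \<in> R \<and> (\<forall>u. m \<le> u \<and> [w, u] \<in> R \<longrightarrow> v \<le> u) \<and>
        nat_at (graph_of x) (bits_segs x) i k v \<and> [k, j, w, Suc v] \<in> row_segs x R)"
  proof (cases "\<exists>v. m \<le> v \<and> [w, v] \<in> R")
    case False
    then have "\<forall>v. m \<le> v \<longrightarrow> [w, v] \<notin> R" by blast
    moreover from enc_row_empty(2)[OF this] s have "i = j" by simp
    ultimately show ?thesis by blast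
  next
    case True
    define v where "v = (LEAST v. m \<le> v \<and> [w, v] \<in> R)"
    have v: "m \<le> v" "[w, v] \<in> R"
      using LeastI_ex[OF True] by (auto simp: v_def)
    have l: "\<forall>u. m \<le> u \<and> [w, u] \<in> R \<longrightarrow> v \<le> u"
      by (auto simp: v_def intro: Least_le)
    have "finite {u. Suc v \<le> u \<and> [w, u] \<in> R}"
      by (rule finite_subset[OF _ fin[of w]]) auto
    from enc_row_least(2)[OF v l this] s
    obtain k where "seg x i k (enc_nat v)" "seg x k j (enc_row R w (Suc v))" by auto
    then have "nat_at (graph_of x) (bits_segs x) i k v" "[k, j, w, Suc v] \<in> row_segs x R"
      by (auto simp: nat_at_complete row_segs_def)
    then show ?thesis using v l by blast
  qed
qed

definition rows_closed :: "nat list set \<Rightarrow> nat \<Rightarrow> nat list set \<Rightarrow> nat list set \<Rightarrow> bool" where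
  "rows_closed X N S O' \<longleftrightarrow> (\<forall>i j w. [i, j, w] \<in> O' \<longrightarrow>
     N \<le> w \<and> i = j \<or>
     (\<exists>k. Suc w \<le> N \<and> char_at X i LB \<and> [Suc i, k, w, 0] \<in> S \<and> char_at X k RB \<and>
        [Suc k, j, Suc w] \<in> O'))"

definition enc_rows :: "nat \<Rightarrow> nat list set \<Rightarrow> nat \<Rightarrow> sym list" where
  "enc_rows N R w =
     concat (map (\<lambda>w. enc_list enc_nat (sorted_list_of_set {v. [w, v] \<in> R})) [w..<N])"

lemma enc_rows_rec:
  "N \<le> w \<Longrightarrow> enc_rows N R w = []"
  "w < N \<Longrightarrow> enc_rows N R w = LB # enc_row R w 0 @ RB # enc_rows N R (Suc w)"
  by (auto simp: enc_rows_def enc_row_def enc_list_def upt_conv_Cons)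

lemma rows_closed_sound:
  assumes B: "bits_closed (graph_of x) B" and S: "row_closed (graph_of x) B R S"
    and O': "rows_closed (graph_of x) N S O'" and "[i, j, w] \<in> O'"
  shows "(\<forall>w'. w \<le> w' \<and> w' < N \<longrightarrow> finite {v. [w', v] \<in> R}) \<and> seg x i j (enc_rows N R w)"
  using assms(4)
proof (induction "N - w" arbitrary: i j w)
  case 0
  then show ?case using O'[unfolded rows_closed_def, rule_format, OF "0.prems"]
    by (auto simp: enc_rows_rec)
next
  case (Suc n)
  then obtain k where k: "i < length x" "x ! i = LB" "[Suc i, k, w, 0] \<in> S" "k < length x"
    "x ! k = RB" "[Suc k, j, Suc w] \<in> O'"
    using O'[unfolded rows_closed_def, rule_format, OF Suc.prems] by auto
  have n: "n = N - Suc w" using Suc.hyps by auto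
  have "w' = w \<or> Suc w \<le> w'" if "w \<le> w'" for w' using that by auto
  then show ?case
    using row_closed_sound[OF B S k(3)] Suc.hyps(1)[OF n k(6)] k Suc.hyps(2)
    by (auto simp: enc_rows_rec)
qed

definition rows_segs :: "sym list \<Rightarrow> nat \<Rightarrow> nat list set \<Rightarrow> nat list set" where
  "rows_segs x N R = {[i, j, w] | i j w. seg x i j (enc_rows N R w)}"

lemma rows_closed_complete:
  "rows_closed (graph_of x) N (row_segs x R) (rows_segs x N R)"
  unfolding rows_closed_def
proof (intro allI impI)
  fix i j w
  assume "[i, j, w] \<in> rows_segs x N R"
  then have "seg x i j (enc_rows N R w)" by (auto simp: rows_segs_def)
  then show "N \<le> w \<and> i = j \<or>
     (\<exists>k. Suc w \<le> N \<and> char_at (graph_of x) i LB \<and> [Suc i, k, w, 0] \<in> row_segs x R \<and>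
        char_at (graph_of x) k RB \<and> [Suc k, j, Suc w] \<in> rows_segs x N R)"
    by (cases "N \<le> w") (auto simp: enc_rows_rec row_segs_def rows_segs_def)
qed

text \<open>Only the arity belonging to the tag matters: 0 is a proposition, 2, 3, 7, 8 are binary,
  the others up to 9 unary. The formula itself is never represented; its meaning enters through the
  translation that the transducer prints.\<close>

definition ltl_closed :: "nat list set \<Rightarrow> nat list set \<Rightarrow> nat list set \<Rightarrow> bool" where
  "ltl_closed X B P \<longleftrightarrow> (\<forall>i j. [i, j] \<in> P \<longrightarrow> char_at X i LB \<and>
     (\<exists>a v. nat_at X B (Suc i) a v \<and>
       (v = 0 \<and> (\<exists>k p. nat_at X B a k p \<and> char_at X k RB \<and> j = Suc k) \<or>
        (v = 1 \<or> v = 4 \<or> v = 5 \<or> v = 6 \<or> v = 9) \<and>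
          (\<exists>k. [a, k] \<in> P \<and> char_at X k RB \<and> j = Suc k) \<or>
        (v = 2 \<or> v = 3 \<or> v = 7 \<or> v = 8) \<and>
          (\<exists>k l. [a, k] \<in> P \<and> [k, l] \<in> P \<and> char_at X l RB \<and> j = Suc l))))"

lemma ltl_closed_sound:
  assumes B: "bits_closed (graph_of x) B" and P: "ltl_closed (graph_of x) B P"
    and "[i, j] \<in> P"
  shows "\<exists>\<phi>. seg x i j (enc_ltl \<phi>)"
  using assms(3)
proof (induction "length x - i" arbitrary: i j rule: less_induct)
  case less
  \<comment> \<open>A child begins behind a nonempty segment starting at \<open>i\<close>, so the
    induction hypothesis applies to it.\<close>
  have less_pos: "length x - k < length x - i" if "seg x i k (c # s)" for k c s
    using that seg_length[OF that] by auto
  from P[unfolded ltl_closed_def, rule_format, OF less.prems]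
  obtain a v where lb: "char_at (graph_of x) i LB" and av: "nat_at (graph_of x) B (Suc i) a v"
    and cases: "v = 0 \<and> (\<exists>k p. nat_at (graph_of x) B a k p \<and> char_at (graph_of x) k RB \<and> j = Suc k) \<or>
        (v = 1 \<or> v = 4 \<or> v = 5 \<or> v = 6 \<or> v = 9) \<and>
          (\<exists>k. [a, k] \<in> P \<and> char_at (graph_of x) k RB \<and> j = Suc k) \<or>
        (v = 2 \<or> v = 3 \<or> v = 7 \<or> v = 8) \<and>
          (\<exists>k l. [a, k] \<in> P \<and> [k, l] \<in> P \<and> char_at (graph_of x) l RB \<and> j = Suc l)"
    by blast
  have hd: "seg x i a (LB # enc_nat v)" using lb nat_at_sound[OF B av] by simp
  have a: "length x - a < length x - i" using less_pos[OF hd] .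
  from cases consider
      (leaf) k p where "v = 0" "nat_at (graph_of x) B a k p" "char_at (graph_of x) k RB" "j = Suc k"
    | (un) k where "v = 1 \<or> v = 4 \<or> v = 5 \<or> v = 6 \<or> v = 9" "[a, k] \<in> P"
        "char_at (graph_of x) k RB" "j = Suc k"
    | (bin) k l where "v = 2 \<or> v = 3 \<or> v = 7 \<or> v = 8" "[a, k] \<in> P" "[k, l] \<in> P"
        "char_at (graph_of x) l RB" "j = Suc l"
    by blast
  then show ?case
  proof cases
    case leaf
    have "seg x i j (enc_ltl (LProp p))"
      using hd leaf nat_at_sound[OF B leaf(2)] by (auto simp: node_def)
    then show ?thesis ..
  next
    case un
    from less.hyps[OF a un(2)] obtain \<phi> where "seg x a k (enc_ltl \<phi>)" ..
    then have "seg x i j (node v [enc_ltl \<phi>])"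
      using hd un(3,4) by (auto simp: node_def)
    moreover have "\<exists>\<psi>. enc_ltl \<psi> = node v [enc_ltl \<phi>]"
      using un(1) enc_ltl.simps(2,5,6,7,10)[of \<phi>] by metis
    ultimately show ?thesis by metis
  next
    case bin
    from less.hyps[OF a bin(2)] obtain \<phi> where \<phi>: "seg x a k (enc_ltl \<phi>)" ..
    then have "seg x i k (LB # enc_nat v @ enc_ltl \<phi>)" using hd by auto
    from less.hyps[OF less_pos[OF this] bin(3)] obtain \<psi> where "seg x k l (enc_ltl \<psi>)" ..
    then have "seg x i j (node v [enc_ltl \<phi>, enc_ltl \<psi>])"
      using hd bin(4,5) \<phi> by (auto simp: node_def)
    moreover have "\<exists>\<chi>. enc_ltl \<chi> = node v [enc_ltl \<phi>, enc_ltl \<psi>]"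
      using bin(1) enc_ltl.simps(3,4,8,9)[of \<phi> \<psi>] by metis
    ultimately show ?thesis by metis
  qed
qed

definition ltl_segs :: "sym list \<Rightarrow> nat list set" where
  "ltl_segs x = {[i, j] | i j. \<exists>\<phi>. seg x i j (enc_ltl \<phi>)}"

lemma ltl_closed_complete: "ltl_closed (graph_of x) (bits_segs x) (ltl_segs x)"
  unfolding ltl_closed_def
proof (intro allI impI)
  fix i j
  assume "[i, j] \<in> ltl_segs x"
  then obtain \<phi> where s: "seg x i j (enc_ltl \<phi>)" by (auto simp: ltl_segs_def)
  have "\<exists>v as. enc_ltl \<phi> = node v as \<and> (v = 0 \<and> (\<exists>p. as = [enc_nat p]) \<or>
      (v = 1 \<or> v = 4 \<or> v = 5 \<or> v = 6 \<or> v = 9) \<and> (\<exists>\<psi>. as = [enc_ltl \<psi>]) \<or>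
      (v = 2 \<or> v = 3 \<or> v = 7 \<or> v = 8) \<and> (\<exists>\<psi> \<chi>. as = [enc_ltl \<psi>, enc_ltl \<chi>]))"
    by (cases \<phi>; simp only: enc_ltl.simps; blast)
  then obtain v as where e: "enc_ltl \<phi> = node v as" and
    shape: "v = 0 \<and> (\<exists>p. as = [enc_nat p]) \<or>
      (v = 1 \<or> v = 4 \<or> v = 5 \<or> v = 6 \<or> v = 9) \<and> (\<exists>\<psi>. as = [enc_ltl \<psi>]) \<or>
      (v = 2 \<or> v = 3 \<or> v = 7 \<or> v = 8) \<and> (\<exists>\<psi> \<chi>. as = [enc_ltl \<psi>, enc_ltl \<chi>])"
    by blast
  from s e obtain a k where lb: "char_at (graph_of x) i LB" and a: "nat_at (graph_of x) (bits_segs x) (Suc i) a v"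
    and as: "seg x a k (concat as)" and rb: "char_at (graph_of x) k RB" "j = Suc k"
    by (auto simp: node_def nat_at_complete)
  have "v = 0 \<and> (\<exists>k p. nat_at (graph_of x) (bits_segs x) a k p \<and> char_at (graph_of x) k RB \<and> j = Suc k) \<or>
        (v = 1 \<or> v = 4 \<or> v = 5 \<or> v = 6 \<or> v = 9) \<and>
          (\<exists>k. [a, k] \<in> ltl_segs x \<and> char_at (graph_of x) k RB \<and> j = Suc k) \<or>
        (v = 2 \<or> v = 3 \<or> v = 7 \<or> v = 8) \<and>
          (\<exists>k l. [a, k] \<in> ltl_segs x \<and> [k, l] \<in> ltl_segs x \<and> char_at (graph_of x) l RB \<and> j = Suc l)"
    using shape
  \<comment> \<open>\<open>shape\<close> and the goal have the same propositional skeleton, so only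
    the three existential leaves remain.\<close>
  proof (elim disj_forward conj_forward)
    assume "\<exists>p. as = [enc_nat p]"
    then show "\<exists>k p. nat_at (graph_of x) (bits_segs x) a k p \<and> char_at (graph_of x) k RB \<and> j = Suc k"
      using as rb by (auto simp: nat_at_complete)
  next
    assume "\<exists>\<psi>. as = [enc_ltl \<psi>]"
    then show "\<exists>k. [a, k] \<in> ltl_segs x \<and> char_at (graph_of x) k RB \<and> j = Suc k"
      using as rb by (auto simp: ltl_segs_def)
  next
    assume "\<exists>\<psi> \<chi>. as = [enc_ltl \<psi>, enc_ltl \<chi>]"
    then obtain \<psi> \<chi> l where "seg x a l (enc_ltl \<psi>)" "seg x l k (enc_ltl \<chi>)" using as by auto
    then show "\<exists>k l. [a, k] \<in> ltl_segs x \<and> [k, l] \<in> ltl_segs x \<and> char_at (graph_of x) l RB \<and> j = Suc l"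
      using rb unfolding ltl_segs_def by simp blast
  qed
  then show "char_at (graph_of x) i LB \<and>
     (\<exists>a v. nat_at (graph_of x) (bits_segs x) (Suc i) a v \<and>
       (v = 0 \<and> (\<exists>k p. nat_at (graph_of x) (bits_segs x) a k p \<and> char_at (graph_of x) k RB \<and> j = Suc k) \<or>
        (v = 1 \<or> v = 4 \<or> v = 5 \<or> v = 6 \<or> v = 9) \<and>
          (\<exists>k. [a, k] \<in> ltl_segs x \<and> char_at (graph_of x) k RB \<and> j = Suc k) \<or>
        (v = 2 \<or> v = 3 \<or> v = 7 \<or> v = 8) \<and>
          (\<exists>k l. [a, k] \<in> ltl_segs x \<and> [k, l] \<in> ltl_segs x \<and> char_at (graph_of x) l RB \<and> j = Suc l)))"
    using lb a by blast
qed

text \<open>The positions \<open>a\<close> to \<open>h\<close> are the joints between consecutive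
  components of an encoded instance. The final conjunct says that the word stops after the last
  bracket.\<close>

definition instance_at :: "nat list set \<Rightarrow> nat list set \<Rightarrow> nat list set \<Rightarrow> nat list set \<Rightarrow> nat list set
    \<Rightarrow> nat \<Rightarrow> nat \<Rightarrow> bool" where
  "instance_at X B O1 O2 P N r \<longleftrightarrow> char_at X 0 LB \<and>
     (\<exists>a. nat_at X B (Suc 0) a 0 \<and> char_at X a LB \<and>
     (\<exists>b. nat_at X B (Suc a) b 0 \<and>
     (\<exists>c. nat_at X B b c N \<and> char_at X c LB \<and>
     (\<exists>d. [Suc c, d, 0] \<in> O1 \<and> char_at X d RB \<and> char_at X (Suc d) LB \<and>
     (\<exists>e. [Suc (Suc d), e, 0] \<in> O2 \<and> char_at X e RB \<and>
     (\<exists>g. nat_at X B (Suc e) g r \<and> char_at X g RB \<and>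
     (\<exists>h. [Suc g, h] \<in> P \<and> char_at X h RB \<and> (\<forall>s. [Suc h, s] \<notin> X))))))))"

text \<open>Finiteness of the labels is supplied by \<open>rows_closed_sound\<close>, since every
  row is spelled out in the word.\<close>

definition structure_ok :: "nat list set \<Rightarrow> nat \<Rightarrow> nat \<Rightarrow> bool" where
  "structure_ok R N r \<longleftrightarrow> Suc r \<le> N \<and> (\<forall>w v. [w, v] \<in> R \<longrightarrow> Suc w \<le> N \<and> Suc v \<le> N) \<and>
     (\<forall>w. Suc w \<le> N \<longrightarrow> (\<exists>v. [w, v] \<in> R))"

definition valid_instance :: "nat list set \<Rightarrow> nat list set \<Rightarrow> nat list set \<Rightarrow> nat \<Rightarrow> nat \<Rightarrow> bool" where
  "valid_instance X R L N r \<longleftrightarrow> structure_ok R N r \<and>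
     (\<exists>B\<subseteq>tuples 3. bits_closed X B \<and>
     (\<exists>S1\<subseteq>tuples 4. row_closed X B R S1 \<and>
     (\<exists>S2\<subseteq>tuples 4. row_closed X B L S2 \<and>
     (\<exists>O1\<subseteq>tuples 3. rows_closed X N S1 O1 \<and>
     (\<exists>O2\<subseteq>tuples 3. rows_closed X N S2 O2 \<and>
     (\<exists>P\<subseteq>tuples 2. ltl_closed X B P \<and> instance_at X B O1 O2 P N r))))))"

definition kripke_of :: "nat list set \<Rightarrow> nat list set \<Rightarrow> nat \<Rightarrow> nat \<Rightarrow> kripke" where
  "kripke_of R L N r =
     \<lparr>nworlds = N, rel = {(w, v). [w, v] \<in> R}, lab = (\<lambda>w. {p. [w, p] \<in> L}), root = r\<rparr>"

lemma enc_instance_kripke_of: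
  "enc_instance (kripke_of R L N r) \<phi> =
     LB # enc_nat 0 @ LB # enc_nat 0 @ enc_nat N @ LB # enc_rows N R 0 @
     RB # LB # enc_rows N L 0 @ RB # enc_nat r @ RB # enc_ltl \<phi> @ [RB]"
  by (simp add: enc_instance_def enc_kripke_def kripke_of_def node_def enc_rows_def enc_list_def)

lemma valid_instance_sound:
  assumes "valid_instance (graph_of x) R L N r"
  shows "\<exists>\<phi>. kripke_wf (kripke_of R L N r) \<and> x = enc_instance (kripke_of R L N r) \<phi>"
proof -
  from assms obtain B S1 S2 O1 O2 P where ok: "structure_ok R N r"
    and B: "bits_closed (graph_of x) B"
    and S: "row_closed (graph_of x) B R S1" "row_closed (graph_of x) B L S2"
    and O12: "rows_closed (graph_of x) N S1 O1" "rows_closed (graph_of x) N S2 O2"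
    and P: "ltl_closed (graph_of x) B P" and inst: "instance_at (graph_of x) B O1 O2 P N r"
    unfolding valid_instance_def by auto
  note rows = rows_closed_sound[OF B S(1) O12(1)] rows_closed_sound[OF B S(2) O12(2)]
  from inst obtain a b c d e g h where i:
    "char_at (graph_of x) 0 LB" "nat_at (graph_of x) B (Suc 0) a 0"
    "char_at (graph_of x) a LB" "nat_at (graph_of x) B (Suc a) b 0"
    "nat_at (graph_of x) B b c N" "char_at (graph_of x) c LB"
    "[Suc c, d, 0] \<in> O1" "char_at (graph_of x) d RB" "char_at (graph_of x) (Suc d) LB"
    "[Suc (Suc d), e, 0] \<in> O2" "char_at (graph_of x) e RB"
    "nat_at (graph_of x) B (Suc e) g r" "char_at (graph_of x) g RB"
    "[Suc g, h] \<in> P" "char_at (graph_of x) h RB" "\<forall>s. [Suc h, s] \<notin> graph_of x"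
    unfolding instance_at_def by blast
  from ltl_closed_sound[OF B P i(14)] obtain \<phi> where \<phi>: "seg x (Suc g) h (enc_ltl \<phi>)" ..
  note nats = i(2,4,5,12)[THEN nat_at_sound[OF B]]
  note seg_appendI = iffD2[OF seg_append, OF exI, OF conjI]
  \<comment> \<open>The segments are glued from right to left, so that the right end stays
    \<open>Suc h\<close>. \<open>seg_append\<close> is switched off to keep the goals from splitting
    into existentials.\<close>
  have "seg x (Suc g) (Suc h) (enc_ltl \<phi> @ [RB])"
    using \<phi> i(15) by auto
  then have "seg x (Suc e) (Suc h) (enc_nat r @ RB # enc_ltl \<phi> @ [RB])"
    using i(13) by (intro seg_appendI[OF nats(4)]) (simp del: seg_append)
  then have "seg x (Suc (Suc d)) (Suc h) (enc_rows N L 0 @ RB # enc_nat r @ RB # enc_ltl \<phi> @ [RB])"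
    using i(11) by (intro seg_appendI[OF conjunct2[OF rows(2)[OF i(10)]]]) (simp del: seg_append)
  then have "seg x (Suc c) (Suc h)
      (enc_rows N R 0 @ RB # LB # enc_rows N L 0 @ RB # enc_nat r @ RB # enc_ltl \<phi> @ [RB])"
    using i(8,9) by (intro seg_appendI[OF conjunct2[OF rows(1)[OF i(7)]]]) (simp del: seg_append)
  then have "seg x b (Suc h) (enc_nat N @ LB # enc_rows N R 0 @
      RB # LB # enc_rows N L 0 @ RB # enc_nat r @ RB # enc_ltl \<phi> @ [RB])"
    using i(6) by (intro seg_appendI[OF nats(3)]) (simp del: seg_append)
  then have "seg x (Suc a) (Suc h) (enc_nat 0 @ enc_nat N @ LB # enc_rows N R 0 @
      RB # LB # enc_rows N L 0 @ RB # enc_nat r @ RB # enc_ltl \<phi> @ [RB])"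
    by (rule seg_appendI[OF nats(2)])
  then have "seg x (Suc 0) (Suc h) (enc_nat 0 @ LB # enc_nat 0 @ enc_nat N @ LB # enc_rows N R 0 @
      RB # LB # enc_rows N L 0 @ RB # enc_nat r @ RB # enc_ltl \<phi> @ [RB])"
    using i(3) by (intro seg_appendI[OF nats(1)]) (simp del: seg_append)
  then have "seg x 0 (Suc h) (enc_instance (kripke_of R L N r) \<phi>)"
    unfolding enc_instance_kripke_of using i(1) by (simp del: seg_append)
  \<comment> \<open>The positions in \<open>graph_of x\<close> are exactly those below
    \<open>length x\<close>, so a vacant position means that the word has ended.\<close>
  moreover have "drop (Suc h) x = []"
    using i(16) by (auto simp: graph_of_def)
  ultimately have "x = enc_instance (kripke_of R L N r) \<phi>"
    using seg_drop by fastforce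
  moreover have "kripke_wf (kripke_of R L N r)"
    using ok rows(2)[OF i(10)] by (auto simp: kripke_wf_def kripke_of_def structure_ok_def Suc_le_eq)
  ultimately show ?thesis by blast
qed

lemma valid_instanceI:
  assumes "structure_ok R N r" "B \<subseteq> tuples 3" "bits_closed X B"
    "S1 \<subseteq> tuples 4" "row_closed X B R S1" "S2 \<subseteq> tuples 4" "row_closed X B L S2"
    "O1 \<subseteq> tuples 3" "rows_closed X N S1 O1" "O2 \<subseteq> tuples 3" "rows_closed X N S2 O2"
    "P \<subseteq> tuples 2" "ltl_closed X B P" "instance_at X B O1 O2 P N r"
  shows "valid_instance X R L N r"
  unfolding valid_instance_def by (intro conjI exI) (fact assms)+

text \<open>The witnesses are the full sets of correct segments. Rows of \<open>R\<close> are finite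
  because \<open>structure_ok\<close> bounds them by \<open>N\<close>; for \<open>L\<close>
  finiteness is assumed for every \<open>w\<close>, as \<open>row_segs\<close> ranges over all of
  them.\<close>

lemma valid_instance_complete:
  assumes "x = enc_instance (kripke_of R L N r) \<phi>" and ok: "structure_ok R N r"
    and fin: "\<And>w. finite {v. [w, v] \<in> L}"
  shows "valid_instance (graph_of x) R L N r"
proof -
  have finR: "finite {v. [w, v] \<in> R}" for w
    by (rule finite_subset[of _ "{..<N}"]) (use ok in \<open>auto simp: structure_ok_def Suc_le_eq\<close>)
  have "seg x 0 (length x) x" using seg_refl[of "[]" x] by simp
  then have "seg x 0 (length x) (enc_instance (kripke_of R L N r) \<phi>)" using assms(1) by simp
  then obtain a b c d e g h where i:
    "char_at (graph_of x) 0 LB" "seg x (Suc 0) a (enc_nat 0)"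
    "char_at (graph_of x) a LB" "seg x (Suc a) b (enc_nat 0)"
    "seg x b c (enc_nat N)" "char_at (graph_of x) c LB"
    "seg x (Suc c) d (enc_rows N R 0)" "char_at (graph_of x) d RB" "char_at (graph_of x) (Suc d) LB"
    "seg x (Suc (Suc d)) e (enc_rows N L 0)" "char_at (graph_of x) e RB"
    "seg x (Suc e) g (enc_nat r)" "char_at (graph_of x) g RB"
    "seg x (Suc g) h (enc_ltl \<phi>)" "char_at (graph_of x) h RB" "Suc h = length x"
    unfolding enc_instance_kripke_of by auto
  have "\<forall>s. [Suc h, s] \<notin> graph_of x" using i(16) by (auto simp: graph_of_def)
  moreover have "[Suc c, d, 0] \<in> rows_segs x N R" "[Suc (Suc d), e, 0] \<in> rows_segs x N L"
    "[Suc g, h] \<in> ltl_segs x"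
    using i(7,10,14) by (auto simp: rows_segs_def ltl_segs_def)
  ultimately have "instance_at (graph_of x) (bits_segs x) (rows_segs x N R) (rows_segs x N L) (ltl_segs x) N r"
    unfolding instance_at_def nat_at_complete using i by blast
  moreover have "bits_segs x \<subseteq> tuples 3" "row_segs x R \<subseteq> tuples 4" "row_segs x L \<subseteq> tuples 4"
    "rows_segs x N R \<subseteq> tuples 3" "rows_segs x N L \<subseteq> tuples 3" "ltl_segs x \<subseteq> tuples 2"
    by (auto simp: tuples_def bits_segs_def row_segs_def rows_segs_def ltl_segs_def)
  ultimately show ?thesis
    using ok bits_closed_complete[of x] row_closed_complete[OF finR] row_closed_complete[OF fin]
      rows_closed_complete ltl_closed_complete by (intro valid_instanceI)
qed

text \<open>Second-order variables: 0 is the word, 1 the edge relation, 2 the labelling, 3 the binary numerals,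
  4 and 6 the (tails of) single rows of edges and labels, 5 and 7 the lists of such rows, 8 the temporal
  formulas. First-order variables 10 and 11 are the number of worlds and the root.\<close>

abbreviation (input) "asuc a \<equiv> APlus a AOne"

section \<open>The conditions as formulas of arithmetic\<close>

definition char_form :: "aterm \<Rightarrow> sym \<Rightarrow> tform" where
  "char_form t c = TIn2 0 2 [t, anum (symcode c)]"

text \<open>Variable 50 occurs nowhere else, so the terms put in for \<open>i\<close>,
  \<open>j\<close> and \<open>v\<close> are not captured.\<close>

definition nat_form :: "aterm \<Rightarrow> aterm \<Rightarrow> aterm \<Rightarrow> tform" where
  "nat_form i j v = TAnd (char_form i LB)
     (TEx1 50 (TConj [TIn2 3 3 [asuc i, AVar 50, v], char_form (AVar 50) RB, TEq j (asuc (AVar 50))]))"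

lemma tsem_char_form [simp]:
  "tsem (char_form t c) s1 s2 s3 \<longleftrightarrow> char_at (s2 0 2) (aeval s1 t) c"
  by (simp add: char_form_def char_at_def)

lemma aeval_upd [simp]: "x \<notin> avars t \<Longrightarrow> aeval (s(x := v)) t = aeval s t"
  by (induction t) auto

lemma tsem_nat_form [simp]:
  "50 \<notin> avars i \<union> avars j \<union> avars v \<Longrightarrow> tsem (nat_form i j v) s1 s2 s3 \<longleftrightarrow>
     nat_at (s2 0 2) (s2 3 3) (aeval s1 i) (aeval s1 j) (aeval s1 v)"
  by (simp add: nat_form_def nat_at_def)

text \<open>This and the following formulas transcribe the predicates quantifier by quantifier. The
  predicates say \<open>Suc w \<le> N\<close> for strict comparison because \<open>TLe\<close> is
  the only order atom.\<close>

definition bits_form :: tform where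
  "bits_form = TAll1 20 (TAll1 21 (TAll1 22 (TImp (TIn2 3 3 [AVar 20, AVar 21, AVar 22])
     (TDisj [TConj [TEq (AVar 22) AZero, TEq (AVar 21) (asuc (AVar 20)), char_form (AVar 20) B0],
        TConj [TEq (AVar 22) AOne, TEq (AVar 21) (asuc (AVar 20)), char_form (AVar 20) B1],
        TEx1 23 (TEx1 24 (TConj [TLe AOne (AVar 23), TIn2 3 3 [AVar 20, AVar 24, AVar 23],
          TEq (AVar 21) (asuc (AVar 24)),
          TDisj [TConj [TEq (AVar 22) (APlus (AVar 23) (AVar 23)), char_form (AVar 24) B0],
            TConj [TEq (AVar 22) (asuc (APlus (AVar 23) (AVar 23))), char_form (AVar 24) B1]]]))]))))"

lemma tsem_bits_form [simp]:
  "tsem bits_form s1 s2 s3 \<longleftrightarrow> bits_closed (s2 0 2) (s2 3 3)"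
  by (simp add: bits_form_def bits_closed_def)

definition row_form :: "nat \<Rightarrow> nat \<Rightarrow> tform" where
  "row_form R S = TAll1 20 (TAll1 21 (TAll1 22 (TAll1 23
     (TImp (TIn2 S 4 [AVar 20, AVar 21, AVar 22, AVar 23])
     (TDisj [TConj [TEq (AVar 20) (AVar 21), TAll1 24 (TImp (TLe (AVar 23) (AVar 24))
          (TNeg (TIn2 R 2 [AVar 22, AVar 24])))],
        TEx1 24 (TEx1 25 (TConj [TLe (AVar 23) (AVar 24), TIn2 R 2 [AVar 22, AVar 24],
          TAll1 26 (TImp (TAnd (TLe (AVar 23) (AVar 26)) (TIn2 R 2 [AVar 22, AVar 26]))
            (TLe (AVar 24) (AVar 26))),
          nat_form (AVar 20) (AVar 25) (AVar 24),
          TIn2 S 4 [AVar 25, AVar 21, AVar 22, asuc (AVar 24)]]))])))))"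

lemma tsem_row_form [simp]:
  "tsem (row_form R S) s1 s2 s3 \<longleftrightarrow> row_closed (s2 0 2) (s2 3 3) (s2 R 2) (s2 S 4)"
  by (simp add: row_form_def row_closed_def)

definition rows_form :: "nat \<Rightarrow> nat \<Rightarrow> tform" where
  "rows_form S O' = TAll1 20 (TAll1 21 (TAll1 22
     (TImp (TIn2 O' 3 [AVar 20, AVar 21, AVar 22])
     (TDisj [TConj [TLe (AVar 10) (AVar 22), TEq (AVar 20) (AVar 21)],
        TEx1 23 (TConj [TLe (asuc (AVar 22)) (AVar 10), char_form (AVar 20) LB,
          TIn2 S 4 [asuc (AVar 20), AVar 23, AVar 22, AZero], char_form (AVar 23) RB,
          TIn2 O' 3 [asuc (AVar 23), AVar 21, asuc (AVar 22)]])]))))"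

lemma tsem_rows_form [simp]:
  "tsem (rows_form S O') s1 s2 s3 \<longleftrightarrow> rows_closed (s2 0 2) (s1 10) (s2 S 4) (s2 O' 3)"
  by (simp add: rows_form_def rows_closed_def)

definition TOneOf :: "nat \<Rightarrow> nat list \<Rightarrow> tform" where
  "TOneOf x ns = TDisj (map (\<lambda>n. TEq (AVar x) (anum n)) ns)"

lemma tsem_TOneOf [simp]: "tsem (TOneOf x ns) s1 s2 s3 \<longleftrightarrow> s1 x \<in> set ns"
  by (induction ns) (auto simp: TOneOf_def)

definition ltl_form :: tform where
  "ltl_form = TAll1 20 (TAll1 21 (TImp (TIn2 8 2 [AVar 20, AVar 21])
     (TAnd (char_form (AVar 20) LB) (TEx1 22 (TEx1 23 (TAnd
       (nat_form (asuc (AVar 20)) (AVar 22) (AVar 23))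
       (TDisj [
         TAnd (TEq (AVar 23) AZero) (TEx1 24 (TEx1 25 (TConj [nat_form (AVar 22) (AVar 24) (AVar 25),
           char_form (AVar 24) RB, TEq (AVar 21) (asuc (AVar 24))]))),
         TAnd (TOneOf 23 [1, 4, 5, 6, 9]) (TEx1 24 (TConj [TIn2 8 2 [AVar 22, AVar 24],
           char_form (AVar 24) RB, TEq (AVar 21) (asuc (AVar 24))])),
         TAnd (TOneOf 23 [2, 3, 7, 8]) (TEx1 24 (TEx1 25 (TConj [TIn2 8 2 [AVar 22, AVar 24],
           TIn2 8 2 [AVar 24, AVar 25],
           char_form (AVar 25) RB, TEq (AVar 21) (asuc (AVar 25))])))])))))))"

lemma tsem_ltl_form [simp]:
  "tsem ltl_form s1 s2 s3 \<longleftrightarrow> ltl_closed (s2 0 2) (s2 3 3) (s2 8 2)"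
  by (simp add: ltl_form_def ltl_closed_def)

definition instance_form :: tform where
  "instance_form = TAnd (char_form AZero LB)
     (TEx1 20 (TConj [nat_form AOne (AVar 20) AZero, char_form (AVar 20) LB,
     TEx1 21 (TConj [nat_form (asuc (AVar 20)) (AVar 21) AZero,
     TEx1 22 (TConj [nat_form (AVar 21) (AVar 22) (AVar 10), char_form (AVar 22) LB,
     TEx1 23 (TConj [TIn2 5 3 [asuc (AVar 22), AVar 23, AZero], char_form (AVar 23) RB,
       char_form (asuc (AVar 23)) LB,
     TEx1 24 (TConj [TIn2 7 3 [asuc (asuc (AVar 23)), AVar 24, AZero], char_form (AVar 24) RB,
     TEx1 25 (TConj [nat_form (asuc (AVar 24)) (AVar 25) (AVar 11), char_form (AVar 25) RB,
     TEx1 26 (TConj [TIn2 8 2 [asuc (AVar 25), AVar 26], char_form (AVar 26) RB,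
       TAll1 27 (TNeg (TIn2 0 2 [asuc (AVar 26), AVar 27]))])])])])])])]))"

lemma tsem_instance_form [simp]:
  "tsem instance_form s1 s2 s3 \<longleftrightarrow>
     instance_at (s2 0 2) (s2 3 3) (s2 5 3) (s2 7 3) (s2 8 2) (s1 10) (s1 11)"
  by (simp add: instance_form_def instance_at_def)

definition structure_form :: tform where
  "structure_form = TConj [TLe (asuc (AVar 11)) (AVar 10),
     TAll1 20 (TAll1 21 (TImp (TIn2 1 2 [AVar 20, AVar 21])
       (TAnd (TLe (asuc (AVar 20)) (AVar 10)) (TLe (asuc (AVar 21)) (AVar 10))))),
     TAll1 20 (TImp (TLe (asuc (AVar 20)) (AVar 10)) (TEx1 21 (TIn2 1 2 [AVar 20, AVar 21])))]"

lemma tsem_structure_form [simp]: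
  "tsem structure_form s1 s2 s3 \<longleftrightarrow> structure_ok (s2 1 2) (s1 10) (s1 11)"
  by (simp add: structure_form_def structure_ok_def)

definition valid_form :: tform where
  "valid_form = TAnd structure_form
     (TEx2 3 3 (TAnd bits_form
     (TEx2 4 4 (TAnd (row_form 1 4)
     (TEx2 6 4 (TAnd (row_form 2 6)
     (TEx2 5 3 (TAnd (rows_form 4 5)
     (TEx2 7 3 (TAnd (rows_form 6 7)
     (TEx2 8 2 (TAnd ltl_form instance_form))))))))))))"

lemma tsem_valid_form:
  "tsem valid_form s1 s2 s3 \<longleftrightarrow>
     valid_instance (s2 0 2) (s2 1 2) (s2 2 2) (s1 10) (s1 11)"
  by (simp add: valid_form_def valid_instance_def)

lemmas valid_form_defs = valid_form_def structure_form_def bits_form_def row_form_def rows_form_def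
  ltl_form_def instance_form_def nat_form_def char_form_def TOneOf_def

lemma twf_valid_form: "twf valid_form"
  by (simp add: valid_form_defs)

lemma fv_valid_form: "fv1 valid_form \<subseteq> {10, 11}" "fv2 valid_form \<subseteq> {(0, 2), (1, 2), (2, 2)}"
    "fv3 valid_form = {}"
  by (auto simp: valid_form_defs)

section \<open>Translation of temporal formulas\<close>

definition enc_trace :: "trace \<Rightarrow> nat list set" where
  "enc_trace t = {[i, p] | i p. p \<in> t i}"

definition enc_team :: "trace set \<Rightarrow> nat list set list set" where
  "enc_team T = (\<lambda>t. [enc_trace t]) ` T"

definition dec_team :: "nat list set list set \<Rightarrow> trace set" where
  "dec_team A = {t. [enc_trace t] \<in> A}"

lemma mem_enc_trace [simp]: "[i, p] \<in> enc_trace t \<longleftrightarrow> p \<in> t i"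
  by (simp add: enc_trace_def)

lemma enc_trace_inject [simp]: "enc_trace t = enc_trace u \<longleftrightarrow> t = u"
proof
  assume e: "enc_trace t = enc_trace u"
  have "p \<in> t i \<longleftrightarrow> p \<in> u i" for i p
    using e mem_enc_trace[of i p t] mem_enc_trace[of i p u] by simp
  then show "t = u" by blast
qed simp

lemma enc_trace_tuples: "enc_trace t \<subseteq> tuples 2"
  by (auto simp: enc_trace_def tuples_def)

lemma tuples_2_enc_trace:
  assumes "A \<subseteq> tuples 2"
  obtains t where "A = enc_trace t"
proof
  show "A = enc_trace (\<lambda>i. {p. [i, p] \<in> A})"
    using assms by (fastforce simp: enc_trace_def tuples_def numeral_2_eq_2 length_Suc_conv)
qed

text \<open>Traces correspond one to one to binary relations on numbers, so quantifiers of arity 2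
  may be read as quantifiers over traces.\<close>

lemma ex_tuples_2 [simp]: "(\<exists>A\<subseteq>tuples 2. P A) \<longleftrightarrow> (\<exists>t. P (enc_trace t))"
  by (metis enc_trace_tuples tuples_2_enc_trace)

lemma all_tuples_2 [simp]: "(\<forall>A\<subseteq>tuples 2. P A) \<longleftrightarrow> (\<forall>t. P (enc_trace t))"
  by (metis enc_trace_tuples tuples_2_enc_trace)

lemma mem_enc_team [simp]: "[enc_trace t] \<in> enc_team T \<longleftrightarrow> t \<in> T"
  by (auto simp: enc_team_def)

lemma dec_enc_team [simp]: "dec_team (enc_team T) = T"
  by (simp add: dec_team_def)

lemma enc_dec_team:
  assumes "A \<subseteq> rel_tuples [2]"
  shows "enc_team (dec_team A) = A"
proof -
  have "\<exists>t. As = [enc_trace t]" if "As \<in> A" for As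
  proof -
    from that assms have "list_all2 (\<lambda>A m. A \<subseteq> tuples m) As [2]" by (auto simp: rel_tuples_def)
    then obtain B where "As = [B]" "B \<subseteq> tuples 2" by (auto simp: list_all2_Cons2)
    then show ?thesis by (metis tuples_2_enc_trace)
  qed
  then show ?thesis by (auto simp: enc_team_def dec_team_def)
qed

lemma enc_team_rel_tuples: "enc_team T \<subseteq> rel_tuples [2]"
  by (auto simp: enc_team_def rel_tuples_def enc_trace_tuples[THEN subsetD])

lemma ex_rel_tuples_2 [simp]: "(\<exists>A\<subseteq>rel_tuples [2]. P A) \<longleftrightarrow> (\<exists>T. P (enc_team T))"
  by (metis enc_team_rel_tuples enc_dec_team)

lemma tsuffix_0 [simp]: "tsuffix 0 T = T"
  by (simp add: tsuffix_def)

text \<open>Third-order variable 0 is the team at the current node; 1 and 2 hold the unshifted teams of its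
  first and second child, and first-order variables 0 and 1 the amounts by which these are shifted.
  The Boolean argument of the functions below tells whether the node is a second child.\<close>

definition TMem :: "nat \<Rightarrow> nat \<Rightarrow> tform" where
  "TMem a i = TIn3 i [2] [(a, 2)]"

text \<open>There is no equality atom for third-order variables; teams are compared through their
  members.\<close>

definition same_team :: "nat \<Rightarrow> nat \<Rightarrow> tform" where
  "same_team i j = TAll2 10 2 (TIff (TMem 10 i) (TMem 10 j))"

definition union_team :: tform where
  "union_team = TAll2 10 2 (TIff (TMem 10 0) (TOr (TMem 10 1) (TMem 10 2)))"

definition singleton_team :: tform where
  "singleton_team = TAll2 11 2 (TIff (TMem 11 1)
     (TAll1 2 (TAll1 3 (TIff (TIn2 11 2 [AVar 2, AVar 3]) (TIn2 10 2 [AVar 2, AVar 3])))))"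

definition child_team :: "bool \<Rightarrow> nat" where
  "child_team \<kappa> = (if \<kappa> then 2 else 1)"

definition child_time :: "bool \<Rightarrow> nat" where
  "child_time \<kappa> = (if \<kappa> then 1 else 0)"

definition shift_team :: "bool \<Rightarrow> tform" where
  "shift_team \<kappa> = TAll2 10 2 (TIff (TMem 10 0) (TEx2 11 2 (TAnd (TMem 11 (child_team \<kappa>))
     (TAll1 2 (TAll1 3 (TIff (TIn2 10 2 [AVar 2, AVar 3])
       (TIn2 11 2 [APlus (AVar 2) (AVar (child_time \<kappa>)), AVar 3])))))))"

definition node_head :: "bool \<Rightarrow> frame list" where
  "node_head \<kappa> = [FEx3 0 [2], FAnd (shift_team \<kappa>)]"

definition current_team :: "bool \<Rightarrow> (nat \<Rightarrow> nat) \<Rightarrow> (nat \<Rightarrow> nat list \<Rightarrow> nat list set list set) \<Rightarrow> trace set" where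
  "current_team \<kappa> s1 s3 = tsuffix (s1 (child_time \<kappa>)) (dec_team (s3 (child_team \<kappa>) [2]))"

lemma set_eqI2: "(\<forall>t. t \<in> A \<longleftrightarrow> t \<in> B) \<longleftrightarrow> A = B"
  by auto

text \<open>\<open>shift_team\<close> has exactly one solution for third-order variable 0, so the
  existential quantifier acts as an assignment.\<close>

lemma tsem_node_head:
  "tsem (plug (node_head \<kappa>) \<phi>) s1 s2 s3 \<longleftrightarrow>
   tsem \<phi> s1 s2 (s3(0 := (s3 0)([2] := enc_team (current_team \<kappa> s1 s3))))"
proof -
  let ?n = "s1 (child_time \<kappa>)" and ?D = "dec_team (s3 (child_team \<kappa>) [2])"
  have "(\<forall>t. t \<in> T \<longleftrightarrow> (\<exists>u. u \<in> ?D \<and> (\<forall>i p. p \<in> t i \<longleftrightarrow> p \<in> u (i + ?n)))) \<longleftrightarrow>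
      T = current_team \<kappa> s1 s3" for T
  proof -
    have "(\<forall>i p. p \<in> t i \<longleftrightarrow> p \<in> u (i + ?n)) \<longleftrightarrow> t = (\<lambda>i. u (i + ?n))" for t u :: trace
      by (auto simp: fun_eq_iff)
    then show ?thesis
      by (auto simp: current_team_def tsuffix_def)
  qed
  then show ?thesis
    by (cases \<kappa>) (simp_all add: node_head_def shift_team_def TMem_def child_team_def child_time_def
        dec_team_def)
qed

section \<open>Translation of the operators\<close>

definition bit_frames :: "sym \<Rightarrow> frame list" where
  "bit_frames c =
     [FEx1 5, FAnd (TEq (AVar 5) (APlus (APlus (AVar 4) (AVar 4)) (if c = B1 then AOne else AZero))),
      FEx1 4, FAnd (TEq (AVar 4) (AVar 5))]"

definition prop_form :: tform where
  "prop_form = TAll2 10 2 (TImp (TMem 10 0) (TIn2 10 2 [AZero, AVar 4]))"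

definition is_binary :: "nat \<Rightarrow> bool" where
  "is_binary tag \<longleftrightarrow> tag \<in> {2, 3, 7, 8}"

definition set_time :: "nat \<Rightarrow> aterm \<Rightarrow> frame list" where
  "set_time n a = [FEx1 n, FAnd (TEq (AVar n) a)]"

definition set_team :: "nat \<Rightarrow> frame list" where
  "set_team i = [FEx3 i [2], FAnd (same_team i 0)]"

text \<open>For U and R (tags 7 and 8) the time of the second child is quantified here, outside the
  binary connective; the earlier time of the first child is quantified inside, by
  \<open>arg_frames\<close>. Negation (tag 1) runs through the members of the team and negates on
  each singleton.\<close>

definition op_frames :: "nat \<Rightarrow> frame list" where
  "op_frames tag =
     (if tag = 0 then set_time 4 AZero
      else if tag = 1 then [FAll2 10 2, FOr (TNeg (TMem 10 0)), FEx3 1 [2], FAnd singleton_team]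
        @ set_time 0 AZero @ [FNeg]
      else if tag = 2 then set_team 1 @ set_team 2 @ set_time 1 AZero
      else if tag = 3 then [FEx3 1 [2], FEx3 2 [2], FAnd union_team] @ set_time 1 AZero
      else if tag = 4 then set_team 1 @ set_time 0 AOne
      else if tag = 5 then set_team 1 @ [FEx1 0]
      else if tag = 6 then set_team 1 @ [FAll1 0]
      else if tag = 7 then set_team 1 @ set_team 2 @ [FEx1 1]
      else if tag = 8 then set_team 1 @ set_team 2 @ [FAll1 1]
      else set_team 1 @ set_time 0 AZero @ [FNeg])"

text \<open>All variants have two frames, matching the two brackets printed when a second child
  begins.\<close>

definition arg_frames :: "nat \<Rightarrow> frame list" where
  "arg_frames tag =
     (if tag = 7 then [FAll1 0, FOr (TLe (AVar 1) (AVar 0))]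
      else if tag = 8 then [FEx1 0, FAnd (TLe (APlus (AVar 0) AOne) (AVar 1))]
      else set_time 0 AZero)"

definition bin_op :: "nat \<Rightarrow> tform \<Rightarrow> tform \<Rightarrow> tform" where
  "bin_op tag = (if tag = 8 then TOr else TAnd)"

definition bin_prefix :: "nat \<Rightarrow> sym list" where
  "bin_prefix tag = LB # enc_nat (if tag = 8 then 6 else 5)"

text \<open>The padding makes every node of the translation end with the same number of closing brackets,
  whatever its operator, so that no stack is needed to emit them.\<close>

definition pad :: "nat \<Rightarrow> frame list \<Rightarrow> frame list" where
  "pad m fs = fs @ replicate (m - length fs) (FAnd TTrue)"

text \<open>Negation needs 7 frames, the most among unary operators, and conjunction 6, the most
  among binary ones. The bracket of \<open>bin_op\<close> makes up the difference, so with the two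
  head frames every node ends in nine brackets.\<close>

definition open_frames :: "bool \<Rightarrow> nat \<Rightarrow> frame list" where
  "open_frames \<kappa> tag = node_head \<kappa> @ pad (if is_binary tag then 6 else 7) (op_frames tag)"

definition leaf_form :: "bool \<Rightarrow> nat \<Rightarrow> tform" where
  "leaf_form \<kappa> p = plug (open_frames \<kappa> 0) (plug (concat (map bit_frames (bits p))) prop_form)"

definition unary_form :: "bool \<Rightarrow> nat \<Rightarrow> tform \<Rightarrow> tform" where
  "unary_form \<kappa> tag \<phi> = plug (open_frames \<kappa> tag) \<phi>"

definition binary_form :: "bool \<Rightarrow> nat \<Rightarrow> tform \<Rightarrow> tform \<Rightarrow> tform" where
  "binary_form \<kappa> tag \<phi> \<psi> = plug (open_frames \<kappa> tag) (bin_op tag (plug (arg_frames tag) \<phi>) \<psi>)"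

primrec translate :: "ltl \<Rightarrow> bool \<Rightarrow> tform" where
  "translate (LProp p) \<kappa> = leaf_form \<kappa> p"
| "translate (LNeg \<phi>) \<kappa> = unary_form \<kappa> 1 (translate \<phi> False)"
| "translate (LAnd \<phi> \<psi>) \<kappa> = binary_form \<kappa> 2 (translate \<phi> False) (translate \<psi> True)"
| "translate (LOr \<phi> \<psi>) \<kappa> = binary_form \<kappa> 3 (translate \<phi> False) (translate \<psi> True)"
| "translate (LX \<phi>) \<kappa> = unary_form \<kappa> 4 (translate \<phi> False)"
| "translate (LF \<phi>) \<kappa> = unary_form \<kappa> 5 (translate \<phi> False)"
| "translate (LG \<phi>) \<kappa> = unary_form \<kappa> 6 (translate \<phi> False)"
| "translate (LU \<phi> \<psi>) \<kappa> = binary_form \<kappa> 7 (translate \<phi> False) (translate \<psi> True)"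
| "translate (LR \<phi> \<psi>) \<kappa> = binary_form \<kappa> 8 (translate \<phi> False) (translate \<psi> True)"
| "translate (LTilde \<phi>) \<kappa> = unary_form \<kappa> 9 (translate \<phi> False)"

text \<open>The padding sits below \<open>fs\<close>, so one also needs that contexts respect
  equivalence of their contents.\<close>

lemma tsem_pad [simp]: "tsem (plug (pad m fs) \<phi>) s1 s2 s3 \<longleftrightarrow> tsem (plug fs \<phi>) s1 s2 s3"
proof -
  have 1: "tsem (plug (replicate k (FAnd TTrue)) \<phi>) s1 s2 s3 \<longleftrightarrow> tsem \<phi> s1 s2 s3" for k \<phi> s1 s2 s3
    by (induction k) auto
  have "tsem (plug fs \<phi>) = tsem (plug fs \<psi>)" if "tsem \<phi> = tsem \<psi>" for \<phi> \<psi>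
  proof (induction fs)
    case (Cons f fs)
    then show ?case by (cases f) (auto simp: fun_eq_iff)
  qed (use that in auto)
  from this[of "plug (replicate (m - length fs) (FAnd TTrue)) \<phi>" \<phi>] 1 show ?thesis
    by (simp add: pad_def fun_eq_iff)
qed

lemma tsem_set_time [simp]:
  "n \<notin> avars a \<Longrightarrow> tsem (plug (set_time n a) \<phi>) s1 s2 s3 \<longleftrightarrow> tsem \<phi> (s1(n := aeval s1 a)) s2 s3"
  by (simp add: set_time_def)

lemma tsem_set_team [simp]:
  "i \<noteq> 0 \<Longrightarrow> s3 0 [2] = enc_team T \<Longrightarrow> tsem (plug (set_team i) \<phi>) s1 s2 s3 \<longleftrightarrow>
     tsem \<phi> s1 s2 (s3(i := (s3 i)([2] := enc_team T)))"
  by (simp add: set_team_def same_team_def TMem_def set_eqI2)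

lemma tsem_union_team:
  "tsem union_team s1 s2 s3 \<longleftrightarrow> dec_team (s3 0 [2]) = dec_team (s3 1 [2]) \<union> dec_team (s3 2 [2])"
  by (auto simp: union_team_def TMem_def dec_team_def)

lemma tsem_singleton_team:
  "s2 10 2 = enc_trace t \<Longrightarrow> tsem singleton_team s1 s2 s3 \<longleftrightarrow> dec_team (s3 1 [2]) = {t}"
proof -
  assume t: "s2 10 2 = enc_trace t"
  have "(\<forall>i p. p \<in> u i \<longleftrightarrow> p \<in> t i) \<longleftrightarrow> u = t" for u by (auto simp: fun_eq_iff)
  then show ?thesis
    by (auto simp: singleton_team_def TMem_def dec_team_def t)
qed

text \<open>Variable 4 is a Horner accumulator and 5 its auxiliary copy; the induction must
  therefore allow any initial value of 4. Computing the index this way lets every digit contribute a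
  fixed text.\<close>

lemma tsem_bit_frames:
  "tsem (plug (concat (map bit_frames cs)) prop_form) s1 s2 s3 \<longleftrightarrow>
   (\<forall>t \<in> dec_team (s3 0 [2]). foldl (\<lambda>v c. 2 * v + (if c = B1 then 1 else 0)) (s1 4) cs \<in> t 0)"
proof (induction cs arbitrary: s1)
  case Nil
  show ?case by (auto simp: prop_form_def TMem_def dec_team_def)
next
  case (Cons c cs)
  have "tsem (plug (bit_frames c) \<phi>) s1 s2 s3 \<longleftrightarrow>
    tsem \<phi> (s1(5 := 2 * s1 4 + (if c = B1 then 1 else 0), 4 := 2 * s1 4 + (if c = B1 then 1 else 0))) s2 s3" for \<phi>
    by (simp add: bit_frames_def mult_2)
  then show ?case by (simp add: Cons.IH)
qed

lemma tsem_leaf_form: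
  "tsem (leaf_form \<kappa> p) s1 s2 s3 \<longleftrightarrow> (\<forall>t\<in>current_team \<kappa> s1 s3. p \<in> t 0)"
  using bitval_bits[of p]
  by (simp add: leaf_form_def open_frames_def tsem_node_head op_frames_def tsem_bit_frames bitval_def)

text \<open>The truth value depends on the assignments only through \<open>current_team\<close>,
  which is why the same variables can be reused at every depth.\<close>

lemma tsem_translate:
  "tsem (translate \<phi> \<kappa>) s1 s2 s3 \<longleftrightarrow> tsat \<phi> (current_team \<kappa> s1 s3)"
proof (induction \<phi> arbitrary: \<kappa> s1 s2 s3)
  case (LProp p)
  show ?case by (simp add: tsem_leaf_form)
next
  case (LNeg \<phi>)
  show ?case
    by (simp add: unary_form_def open_frames_def tsem_node_head op_frames_def LNeg.IH
        tsem_singleton_team TMem_def current_team_def child_team_def child_time_def) blast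
next
  case (LAnd \<phi> \<psi>)
  show ?case
    by (simp add: binary_form_def open_frames_def tsem_node_head op_frames_def LAnd.IH bin_op_def
        arg_frames_def current_team_def child_team_def child_time_def)
next
  case (LOr \<phi> \<psi>)
  show ?case
    by (simp add: binary_form_def open_frames_def tsem_node_head op_frames_def LOr.IH bin_op_def
        arg_frames_def tsem_union_team current_team_def child_team_def child_time_def)
next
  case (LX \<phi>)
  show ?case
    by (simp add: unary_form_def open_frames_def tsem_node_head op_frames_def LX.IH
        current_team_def child_team_def child_time_def)
next
  case (LF \<phi>)
  show ?case
    by (simp add: unary_form_def open_frames_def tsem_node_head op_frames_def LF.IH
        current_team_def child_team_def child_time_def)
next
  case (LG \<phi>)
  show ?case
    by (simp add: unary_form_def open_frames_def tsem_node_head op_frames_def LG.IH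
        current_team_def child_team_def child_time_def)
next
  case (LU \<phi> \<psi>)
  show ?case
    by (simp add: binary_form_def open_frames_def tsem_node_head op_frames_def LU.IH bin_op_def
        arg_frames_def current_team_def child_team_def child_time_def) (metis not_le)
next
  case (LR \<phi> \<psi>)
  show ?case
    by (simp add: binary_form_def open_frames_def tsem_node_head op_frames_def LR.IH bin_op_def
        arg_frames_def current_team_def child_team_def child_time_def) (auto simp: Suc_le_eq)
next
  case (LTilde \<phi>)
  show ?case
    by (simp add: unary_form_def open_frames_def tsem_node_head op_frames_def LTilde.IH
        current_team_def child_team_def child_time_def)
qed

section \<open>Free variables of the translation\<close>

definition child_closed :: "bool \<Rightarrow> tform \<Rightarrow> bool" where
  "child_closed \<kappa> \<phi> \<longleftrightarrow> twf \<phi> \<and> fv1 \<phi> \<subseteq> {child_time \<kappa>} \<and> fv2 \<phi> = {} \<and>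
     fv3 \<phi> \<subseteq> {(child_team \<kappa>, [2])}"

text \<open>The state of affairs just below the head of a node: times and child teams are bound by
  the operator, and only the current team is still free.\<close>

definition node_closed :: "tform \<Rightarrow> bool" where
  "node_closed \<phi> \<longleftrightarrow> twf \<phi> \<and> fv1 \<phi> = {} \<and> fv2 \<phi> = {} \<and> fv3 \<phi> \<subseteq> {(0, [2])}"

lemma fv_frames [simp]:
  "twf (plug (set_time n a) \<phi>) = twf \<phi>"
  "fv1 (plug (set_time n a) \<phi>) = avars a \<union> fv1 \<phi> - {n}"
  "fv2 (plug (set_time n a) \<phi>) = fv2 \<phi>"
  "fv3 (plug (set_time n a) \<phi>) = fv3 \<phi>"
  "twf (plug (set_team i) \<phi>) = twf \<phi>"
  "fv1 (plug (set_team i) \<phi>) = fv1 \<phi>"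
  "fv2 (plug (set_team i) \<phi>) = fv2 \<phi>"
  "fv3 (plug (set_team i) \<phi>) = insert (0, [2]) (fv3 \<phi>) - {(i, [2])}"
  "twf (plug (replicate k (FAnd TTrue)) \<phi>) = twf \<phi>"
  "fv1 (plug (replicate k (FAnd TTrue)) \<phi>) = fv1 \<phi>"
  "fv2 (plug (replicate k (FAnd TTrue)) \<phi>) = fv2 \<phi>"
  "fv3 (plug (replicate k (FAnd TTrue)) \<phi>) = fv3 \<phi>"
proof -
  show "twf (plug (replicate k (FAnd TTrue)) \<phi>) = twf \<phi>"
    "fv1 (plug (replicate k (FAnd TTrue)) \<phi>) = fv1 \<phi>"
    "fv2 (plug (replicate k (FAnd TTrue)) \<phi>) = fv2 \<phi>"
    "fv3 (plug (replicate k (FAnd TTrue)) \<phi>) = fv3 \<phi>"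
    by (induction k) auto
qed (auto simp: set_time_def set_team_def same_team_def TMem_def)

lemma child_closed_node_head: "node_closed \<phi> \<Longrightarrow> child_closed \<kappa> (plug (node_head \<kappa>) \<phi>)"
  by (auto simp: child_closed_def node_closed_def node_head_def shift_team_def TMem_def)

lemma node_closed_pad: "node_closed (plug fs \<phi>) \<Longrightarrow> node_closed (plug (pad m fs) \<phi>)"
proof -
  have "fv1 (plug fs (plug (replicate k (FAnd TTrue)) \<phi>)) = fv1 (plug fs \<phi>)"
    "fv2 (plug fs (plug (replicate k (FAnd TTrue)) \<phi>)) = fv2 (plug fs \<phi>)"
    "fv3 (plug fs (plug (replicate k (FAnd TTrue)) \<phi>)) = fv3 (plug fs \<phi>)"
    "twf (plug fs (plug (replicate k (FAnd TTrue)) \<phi>)) = twf (plug fs \<phi>)" for k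
  proof (induction fs)
    case (Cons f fs)
    { case 1 show ?case using Cons by (cases f) auto }
    { case 2 show ?case using Cons by (cases f) auto }
    { case 3 show ?case using Cons by (cases f) auto }
    { case 4 show ?case using Cons by (cases f) auto }
  qed simp_all
  then show "node_closed (plug fs \<phi>) \<Longrightarrow> node_closed (plug (pad m fs) \<phi>)"
    by (simp add: node_closed_def pad_def)
qed

lemma child_closed_unary:
  assumes "child_closed False \<phi>" "tag \<in> {1, 4, 5, 6, 9}"
  shows "child_closed \<kappa> (unary_form \<kappa> tag \<phi>)"
proof -
  have "twf \<phi>" "fv1 \<phi> \<subseteq> {0}" "fv2 \<phi> = {}" "fv3 \<phi> \<subseteq> {(1, [2])}"
    using assms(1) by (auto simp: child_closed_def child_time_def child_team_def)
  then have "node_closed (plug (op_frames tag) \<phi>)"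
    using assms(2)
    by (elim insertE) (auto simp: node_closed_def op_frames_def singleton_team_def TMem_def)
  then show ?thesis
    by (simp add: unary_form_def open_frames_def child_closed_node_head node_closed_pad)
qed

lemma child_closed_binary:
  assumes "child_closed False \<phi>" "child_closed True \<psi>" "tag \<in> {2, 3, 7, 8}"
  shows "child_closed \<kappa> (binary_form \<kappa> tag \<phi> \<psi>)"
proof -
  have "twf \<phi>" "fv1 \<phi> \<subseteq> {0}" "fv2 \<phi> = {}" "fv3 \<phi> \<subseteq> {(1, [2])}"
    "twf \<psi>" "fv1 \<psi> \<subseteq> {1}" "fv2 \<psi> = {}" "fv3 \<psi> \<subseteq> {(2, [2])}"
    using assms(1,2) by (auto simp: child_closed_def child_time_def child_team_def)
  then have "node_closed (plug (op_frames tag) (bin_op tag (plug (arg_frames tag) \<phi>) \<psi>))"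
    using assms(3)
    by (elim insertE) (auto simp: node_closed_def op_frames_def union_team_def TMem_def bin_op_def
        arg_frames_def)
  then show ?thesis
    by (simp add: binary_form_def open_frames_def child_closed_node_head node_closed_pad)
qed

lemma child_closed_leaf: "child_closed \<kappa> (leaf_form \<kappa> p)"
proof -
  have "twf (plug (concat (map bit_frames cs)) prop_form) \<and>
    fv1 (plug (concat (map bit_frames cs)) prop_form) \<subseteq> {4} \<and>
    fv2 (plug (concat (map bit_frames cs)) prop_form) = {} \<and>
    fv3 (plug (concat (map bit_frames cs)) prop_form) \<subseteq> {(0, [2])}" for cs
    by (induction cs) (auto simp: bit_frames_def prop_form_def TMem_def split: if_splits)
  then have "node_closed (plug (op_frames 0) (plug (concat (map bit_frames (bits p))) prop_form))"
    unfolding node_closed_def op_frames_def by auto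
  then show ?thesis
    by (simp add: leaf_form_def open_frames_def child_closed_node_head node_closed_pad)
qed

lemma child_closed_translate: "child_closed \<kappa> (translate \<phi> \<kappa>)"
  by (induction \<phi> arbitrary: \<kappa>)
    (simp_all add: child_closed_unary child_closed_binary child_closed_leaf)

section \<open>The reduction and its correctness\<close>

definition trace_set_form :: tform where
  "trace_set_form = TAll2 10 2 (TIff (TMem 10 1) (TEx2 9 2 (TConj [
     TAll1 20 (TEx1 21 (TIn2 9 2 [AVar 20, AVar 21])),
     TAll1 20 (TAll1 21 (TAll1 22 (TImp
       (TAnd (TIn2 9 2 [AVar 20, AVar 21]) (TIn2 9 2 [AVar 20, AVar 22])) (TEq (AVar 21) (AVar 22))))),
     TIn2 9 2 [AZero, AVar 11],
     TAll1 20 (TAll1 21 (TAll1 22 (TImp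
       (TAnd (TIn2 9 2 [AVar 20, AVar 21]) (TIn2 9 2 [asuc (AVar 20), AVar 22]))
       (TIn2 1 2 [AVar 21, AVar 22])))),
     TAll1 20 (TAll1 21 (TIff (TIn2 10 2 [AVar 20, AVar 21])
       (TEx1 22 (TAnd (TIn2 9 2 [AVar 20, AVar 22]) (TIn2 2 2 [AVar 22, AVar 21])))))])))"

lemma tsem_trace_set_form:
  "tsem trace_set_form s1 s2 s3 \<longleftrightarrow>
   dec_team (s3 1 [2]) = traces (kripke_of (s2 1 2) (s2 2 2) N (s1 11))"
proof -
  let ?K = "kripke_of (s2 1 2) (s2 2 2) N (s1 11)"
  \<comment> \<open>The path is a binary relation and is thus decoded as a trace, a function into
    sets of worlds. The first two conditions make all these sets singletons.\<close>
  have "(\<exists>\<pi>. (\<forall>i. \<exists>w. w \<in> \<pi> i) \<and> (\<forall>i w v. w \<in> \<pi> i \<and> v \<in> \<pi> i \<longrightarrow> w = v) \<and> s1 11 \<in> \<pi> 0 \<and>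
      (\<forall>i w v. w \<in> \<pi> i \<and> v \<in> \<pi> (Suc i) \<longrightarrow> [w, v] \<in> s2 1 2) \<and>
      (\<forall>i p. p \<in> t i \<longleftrightarrow> (\<exists>w. w \<in> \<pi> i \<and> [w, p] \<in> s2 2 2))) \<longleftrightarrow> t \<in> traces ?K"
    (is "(\<exists>\<pi>. ?P \<pi>) \<longleftrightarrow> _") for t
  proof
    assume "\<exists>\<pi>. ?P \<pi>"
    then obtain \<pi> where \<pi>: "?P \<pi>" ..
    then have "\<exists>\<rho>. \<forall>i. \<rho> i \<in> \<pi> i" by (intro choice) blast
    then obtain \<rho> where "\<forall>i. \<rho> i \<in> \<pi> i" ..
    with \<pi> have \<rho>: "\<pi> i = {\<rho> i}" for i by blast
    have "is_path ?K \<rho>" using \<pi> by (simp add: is_path_def kripke_of_def \<rho>)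
    moreover have "t = (\<lambda>i. lab ?K (\<rho> i))" using \<pi> by (auto simp: kripke_of_def \<rho>)
    ultimately show "t \<in> traces ?K" by (auto simp: traces_def)
  next
    assume "t \<in> traces ?K"
    then obtain \<rho> where "is_path ?K \<rho>" "t = (\<lambda>i. lab ?K (\<rho> i))" by (auto simp: traces_def)
    then show "\<exists>\<pi>. ?P \<pi>"
      by (intro exI[of _ "\<lambda>i. {\<rho> i}"]) (auto simp: is_path_def kripke_of_def)
  qed
  then show ?thesis
    by (simp add: trace_set_form_def TMem_def dec_team_def set_eq_iff)
qed

text \<open>The whole temporal formula is treated as a first child: its team is third-order variable
  1, and its shift, variable 0, is set to zero.\<close>

definition outer_frames :: "frame list" where
  "outer_frames = [FEx2 1 2, FEx2 2 2, FEx1 10, FEx1 11, FAnd valid_form,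
     FEx3 1 [2], FAnd trace_set_form, FEx1 0, FAnd (TEq (AVar 0) AZero)]"

definition sentence_frames :: "sym list \<Rightarrow> frame list" where
  "sentence_frames x = [FEx2 0 2, FAnd (word_form x)] @ outer_frames"

lemma tsem_outer_frames:
  "tsem (plug outer_frames \<psi>) s1 s2 s3 \<longleftrightarrow>
   (\<exists>R\<subseteq>tuples 2. \<exists>L\<subseteq>tuples 2. \<exists>N r. valid_instance (s2 0 2) R L N r \<and>
      tsem \<psi> (s1(10 := N, 11 := r, 0 := 0)) (s2(1 := (s2 1)(2 := R), 2 := (s2 2)(2 := L)))
        (s3(1 := (s3 1)([2] := enc_team (traces (kripke_of R L N r))))))"
  unfolding outer_frames_def plug_simps fill.simps tsem.simps ex_rel_tuples_2
    tsem_valid_form tsem_trace_set_form[where N = "s 10" and ?s1.0 = s for s]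
  \<comment> \<open>These binary relations are edges and labels and must not be decoded as
    traces.\<close>
  by (simp del: ex_tuples_2)

text \<open>As \<open>\<psi>\<close> is arbitrary, truth forces a valid instance no matter what the
  transducer printed in its place.\<close>

lemma true_sentence:
  "true_in_N (plug (sentence_frames x) \<psi>) \<longleftrightarrow>
   (\<exists>R\<subseteq>tuples 2. \<exists>L\<subseteq>tuples 2. \<exists>N r. valid_instance (graph_of x) R L N r \<and>
      tsem \<psi> ((\<lambda>_. 0)(10 := N, 11 := r, 0 := 0))
        ((\<lambda>_ _. {})(0 := (\<lambda>_. {})(2 := graph_of x), 1 := (\<lambda>_. {})(2 := R), 2 := (\<lambda>_. {})(2 := L)))
        ((\<lambda>_ _. {})(1 := (\<lambda>_. {})([2] := enc_team (traces (kripke_of R L N r))))))"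
proof -
  have graph: "graph_of x \<subseteq> tuples 2" by (auto simp: graph_of_def tuples_def)
  have "true_in_N (plug (sentence_frames x) \<psi>) \<longleftrightarrow>
    (\<exists>X. X \<subseteq> tuples 2 \<and> X = graph_of x \<and>
      tsem (plug outer_frames \<psi>) (\<lambda>_. 0) ((\<lambda>_ _. {})(0 := (\<lambda>_. {})(2 := X))) (\<lambda>_ _. {}))"
    unfolding true_in_N_def sentence_frames_def plug_simps fill.simps tsem.simps
    by (intro ex_cong1 conj_cong refl) (simp add: tsem_word_form)
  also have "\<dots> \<longleftrightarrow> tsem (plug outer_frames \<psi>) (\<lambda>_. 0)
      ((\<lambda>_ _. {})(0 := (\<lambda>_. {})(2 := graph_of x))) (\<lambda>_ _. {})"
    using graph by blast
  finally show ?thesis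
    by (simp add: tsem_outer_frames del: ex_tuples_2)
qed

lemma sentence_closed:
  assumes "twf \<psi>" "fv1 \<psi> \<subseteq> {0}" "fv2 \<psi> = {}" "fv3 \<psi> \<subseteq> {(1, [2])}"
  shows "twf (plug (sentence_frames x) \<psi>)" "closed_tform (plug (sentence_frames x) \<psi>)"
  using assms fv_valid_form fv_word_form[of x] twf_valid_form
  by (auto simp: sentence_frames_def outer_frames_def closed_tform_def trace_set_form_def TMem_def)

text \<open>\<open>K\<close> may have arbitrary, even infinite, labels outside its worlds, so
  \<open>L\<close> is cut off there. Neither the encoding nor the traces notice, because paths stay
  among the worlds.\<close>

lemma kripke_of_kripke:
  assumes "kripke_wf K"
  obtains R L where "R \<subseteq> tuples 2" "L \<subseteq> tuples 2" "structure_ok R (nworlds K) (root K)"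
    "\<And>w. finite {v. [w, v] \<in> L}"
    "\<And>\<phi>. enc_instance (kripke_of R L (nworlds K) (root K)) \<phi> = enc_instance K \<phi>"
    "traces (kripke_of R L (nworlds K) (root K)) = traces K"
proof
  let ?R = "{[w, v] | w v. (w, v) \<in> rel K}" and ?L = "{[w, p] | w p. w < nworlds K \<and> p \<in> lab K w}"
  let ?K = "kripke_of ?R ?L (nworlds K) (root K)"
  show "?R \<subseteq> tuples 2" "?L \<subseteq> tuples 2" by (auto simp: tuples_def)
  show "structure_ok ?R (nworlds K) (root K)"
    using assms by (auto simp: structure_ok_def kripke_wf_def Suc_le_eq)
  show "finite {v. [w, v] \<in> ?L}" for w
    using assms by (cases "w < nworlds K") (auto simp: kripke_wf_def)
  have "enc_rows (nworlds K) ?L 0 =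
      concat (map (\<lambda>w. enc_list enc_nat (sorted_list_of_set (lab K w))) [0..<nworlds K])"
    unfolding enc_rows_def by (intro arg_cong[of _ _ concat] map_cong refl) simp
  moreover have "enc_rows (nworlds K) ?R 0 =
      concat (map (\<lambda>w. enc_list enc_nat (sorted_list_of_set {v. (w, v) \<in> rel K})) [0..<nworlds K])"
    unfolding enc_rows_def by simp
  ultimately show "enc_instance ?K \<phi> = enc_instance K \<phi>" for \<phi>
    by (simp only: enc_instance_kripke_of)
      (simp add: enc_instance_def enc_kripke_def node_def enc_list_def[of _ "[0..<nworlds K]"])
  have "is_path ?K = is_path K"
    by (simp add: is_path_def kripke_of_def fun_eq_iff)
  moreover have "(\<lambda>i. lab ?K (\<pi> i)) = (\<lambda>i. lab K (\<pi> i))" if "is_path K \<pi>" for \<pi>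
  proof -
    have "\<pi> i < nworlds K" for i
      using that assms by (auto simp: is_path_def kripke_wf_def dest!: spec[of _ i])
    then show ?thesis by (simp add: kripke_of_def)
  qed
  ultimately show "traces ?K = traces K"
    unfolding traces_def setcompr_eq_image by (intro image_cong) auto
qed

text \<open>\<open>Init\<close> passes the four symbols that open an instance, a bracket and the tag
  0. \<open>After\<close> replaces a stack: behind a complete node an opening bracket can only begin
  a second child, and a closing one can only end the parent. \<open>LeafBack\<close> and
  \<open>LeafForward\<close> occur only in the two-way machine.\<close>

datatype state =
    Start | WordForward | WordBackward | Init nat | Skip nat | First | Open bool | Tag bool nat
  | LeafOpen | LeafBits | LeafBack | LeafForward | After | Halt

text \<open>Encodings of Kripke structures have bracket depth 4, so a saturating counter finds their
  end; tags above 9 only occur in ill-formed words. The second argument of \<open>emit\<close> and \<open>transduce\<close> is the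
  part of the word already read, in reverse.\<close>

definition is_bit :: "sym \<Rightarrow> bool" where
  "is_bit c \<longleftrightarrow> c = B0 \<or> c = B1"

fun next_state :: "state \<Rightarrow> sym \<Rightarrow> state" where
  "next_state (Init n) c = (if n < 3 then Init (Suc n) else Skip 0)"
| "next_state (Skip d) LB = Skip (min 5 (Suc d))"
| "next_state (Skip d) RB = (if d \<le> 1 then First else Skip (d - 1))"
| "next_state First LB = Open False"
| "next_state (Open \<kappa>) LB = Tag \<kappa> 0"
| "next_state (Tag \<kappa> v) B0 = Tag \<kappa> (min 9 (2 * v))"
| "next_state (Tag \<kappa> v) B1 = Tag \<kappa> (min 9 (Suc (2 * v)))"
| "next_state (Tag \<kappa> v) RB = (if v = 0 then LeafOpen else First)"
| "next_state LeafOpen LB = LeafBits"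
| "next_state LeafBits RB = After"
| "next_state After LB = Open True"
| "next_state s c = s"

fun emit :: "state \<Rightarrow> sym list \<Rightarrow> sym \<Rightarrow> sym list" where
  "emit (Tag \<kappa> v) u RB = frames_prefix (open_frames \<kappa> v) @
     (if is_binary v then bin_prefix v @ frames_prefix (arg_frames v) else [])"
| "emit LeafBits u RB =
     enc_tform prop_form @ concat (map (\<lambda>_. replicate 4 RB) (takeWhile is_bit u))"
| "emit LeafBits u B0 = frames_prefix (bit_frames B0)"
| "emit LeafBits u B1 = frames_prefix (bit_frames B1)"
| "emit After u LB = [RB, RB]"
| "emit After u RB = replicate 9 RB"
| "emit s u c = []"

primrec transduce :: "state \<Rightarrow> sym list \<Rightarrow> sym list \<Rightarrow> sym list" where
  "transduce s u [] = []"
| "transduce s u (c # v) = emit s u c @ transduce (next_state s c) (c # u) v"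

lemma transduce_append [simp]:
  "transduce s u (v @ w) = transduce s u v @ transduce (foldl next_state s v) (rev v @ u) w"
  by (induction v arbitrary: s u) auto

text \<open>The order is that of a machine that sweeps forward, backward and forward again;
  \<open>rev x\<close> marks the backward sweep. The first \<open>[RB, RB]\<close> closes
  \<open>word_start\<close>.\<close>

definition reduction :: "sym list \<Rightarrow> sym list" where
  "reduction x =
     frames_prefix [FEx2 0 2] @ LB # enc_nat 5 @ frames_prefix word_start @
     concat (map (\<lambda>c. frames_prefix (word_block c)) x) @ enc_tform word_end @
     concat (map (\<lambda>_. replicate 5 RB) (rev x)) @ [RB, RB] @ frames_prefix outer_frames @
     transduce (Init 0) [] x @ [RB, RB]"

lemma reduction_eq:
  "reduction x = frames_prefix (sentence_frames x) @ transduce (Init 0) [] x @ [RB, RB]"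
proof -
  have p: "frames_prefix (concat (map word_block x)) = concat (map (\<lambda>c. frames_prefix (word_block c)) x)"
    by (induction x) auto
  have l: "length (concat (map word_block x)) = 5 * length x"
    by (induction x) (auto simp: word_block_def)
  have r: "concat (map (\<lambda>_. replicate k RB) xs) = replicate (k * length xs) RB" for k and xs :: "sym list"
    by (induction xs) (auto simp: replicate_add[symmetric])
  have "enc_tform (word_form x) = frames_prefix word_start @
     concat (map (\<lambda>c. frames_prefix (word_block c)) x) @ enc_tform word_end @
     concat (map (\<lambda>_. replicate 5 RB) (rev x)) @ [RB, RB]"
    unfolding word_form_def enc_plug r
    by (simp add: p l replicate_add word_start_def numeral_2_eq_2 flip: replicate_append_same)
  then show ?thesis
    by (simp add: reduction_def sentence_frames_def)
qed

section \<open>The transduction on well-formed instances\<close>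

definition quiet :: "nat \<Rightarrow> sym list \<Rightarrow> bool" where
  "quiet d s \<longleftrightarrow> (\<forall>u. transduce (Skip d) u s = []) \<and> foldl next_state (Skip d) s = Skip d"

lemma quiet_Nil: "quiet d []"
  by (simp add: quiet_def)

lemma quiet_append: "quiet d s \<Longrightarrow> quiet d t \<Longrightarrow> quiet d (s @ t)"
  by (simp add: quiet_def)

text \<open>\<open>1 \<le> d\<close> prevents the closing bracket from ending the skipped part, and
  \<open>d \<le> 4\<close> keeps the depth counter exact.\<close>

lemma quiet_brackets: "quiet (Suc d) s \<Longrightarrow> 1 \<le> d \<Longrightarrow> d \<le> 4 \<Longrightarrow> quiet d (LB # s @ [RB])"
proof -
  assume "quiet (Suc d) s" "1 \<le> d" "d \<le> 4"
  moreover from this have "min 5 (Suc d) = Suc d" by simp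
  ultimately show ?thesis by (simp add: quiet_def del: min_Suc_numeral min_numeral_Suc)
qed

lemma quiet_bits: "set s \<subseteq> {B0, B1} \<Longrightarrow> quiet d s"
proof (induction s)
  case (Cons c s)
  then have "quiet d s" "c = B0 \<or> c = B1" by auto
  then show ?case by (auto simp: quiet_def)
qed (simp add: quiet_Nil)

lemma quiet_enc_nat: "1 \<le> d \<Longrightarrow> d \<le> 4 \<Longrightarrow> quiet d (enc_nat n)"
  unfolding enc_nat_def using bits_subset by (intro quiet_brackets quiet_bits) auto

lemma quiet_enc_list:
  assumes "\<And>a. quiet (Suc d) (f a)" "1 \<le> d" "d \<le> 4"
  shows "quiet d (enc_list f as)"
proof -
  have "quiet (Suc d) (concat (map f as))"
    by (induction as) (auto intro: quiet_append quiet_Nil assms(1))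
  then show ?thesis unfolding enc_list_def using assms by (intro quiet_brackets)
qed

lemma transduce_kripke:
  "transduce (Init 0) u (LB # enc_nat 0 @ enc_kripke K) = [] \<and>
   foldl next_state (Init 0) (LB # enc_nat 0 @ enc_kripke K) = First"
proof -
  have "\<exists>s. enc_kripke K = LB # s @ [RB] \<and> quiet 1 s"
    unfolding enc_kripke_def node_def
    by (intro exI conjI refl) (auto intro!: quiet_append quiet_Nil quiet_enc_nat quiet_enc_list)
  then obtain s where "enc_kripke K = LB # s @ [RB]" "quiet 1 s" by blast
  moreover have "bits 0 = [B0]" by (simp add: bits_rec)
  ultimately show ?thesis
    by (simp add: enc_nat_def quiet_def)
qed

lemma transduce_tag:
  assumes "v \<le> 9"
  shows "transduce (Open \<kappa>) u (enc_nat v) = frames_prefix (open_frames \<kappa> v) @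
     (if is_binary v then bin_prefix v @ frames_prefix (arg_frames v) else [])"
    and "foldl next_state (Open \<kappa>) (enc_nat v) = (if v = 0 then LeafOpen else First)"
proof -
  have quiet: "transduce (Tag \<kappa> w) u s = []" if "set s \<subseteq> {B0, B1}" for w u s
    using that by (induction s arbitrary: w u) auto
  have bits': "bits n = (if n < 2 then [if n = 0 then B0 else B1]
             else bits (n div 2) @ [if n mod 2 = 0 then B0 else B1])" for n by (rule bits.simps)
  \<comment> \<open>There are only ten tags, so the reading of their digits is simply
    computed.\<close>
  have "v \<in> {0, 1, 2, 3, 4, 5, 6, 7, 8, 9}" using assms by auto
  then have "foldl next_state (Tag \<kappa> 0) (bits v) = Tag \<kappa> v"
    by (elim insertE) (simp_all add: bits'[of 0] bits'[of 1] bits'[of 2] bits'[of 3] bits'[of 4]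
        bits'[of 5] bits'[of 6] bits'[of 7] bits'[of 8] bits'[of 9] bits'[of "Suc 0"])
  then show "transduce (Open \<kappa>) u (enc_nat v) = frames_prefix (open_frames \<kappa> v) @
     (if is_binary v then bin_prefix v @ frames_prefix (arg_frames v) else [])"
    and "foldl next_state (Open \<kappa>) (enc_nat v) = (if v = 0 then LeafOpen else First)"
    using quiet[OF bits_subset] by (simp_all add: enc_nat_def)
qed

lemma transduce_leaf:
  "transduce LeafOpen u (enc_nat p) =
     frames_prefix (concat (map bit_frames (bits p))) @ enc_tform prop_form @
     replicate (length (concat (map bit_frames (bits p)))) RB"
  "foldl next_state LeafOpen (enc_nat p) = After"
proof -
  have fwd: "transduce LeafBits u s = frames_prefix (concat (map bit_frames s)) \<and>
      foldl next_state LeafBits s = LeafBits"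
    if "set s \<subseteq> {B0, B1}" for s u
    using that by (induction s arbitrary: u) auto
  have tw: "takeWhile is_bit (rev s @ LB # u) = rev s" if "set s \<subseteq> {B0, B1}" for s u
    using that by (subst takeWhile_append2) (auto simp: is_bit_def)
  have "concat (map (\<lambda>_. replicate 4 RB) (rev s)) = replicate (length (concat (map bit_frames s))) RB"
    for s :: "sym list"
    by (induction s) (simp_all add: bit_frames_def eval_nat_numeral replicate_append_same
        flip: replicate_Suc replicate_add)
  then show "transduce LeafOpen u (enc_nat p) =
     frames_prefix (concat (map bit_frames (bits p))) @ enc_tform prop_form @
     replicate (length (concat (map bit_frames (bits p)))) RB"
    "foldl next_state LeafOpen (enc_nat p) = After"
    using fwd[OF bits_subset] tw[OF bits_subset] by (simp_all add: enc_nat_def)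
qed

lemma length_open_frames: "v \<le> 9 \<Longrightarrow> length (open_frames \<kappa> v) = (if is_binary v then 8 else 9)"
  by (auto simp: open_frames_def node_head_def pad_def op_frames_def set_time_def set_team_def
      is_binary_def)

lemma length_arg_frames: "length (arg_frames v) = 2"
  by (simp add: arg_frames_def set_time_def)

text \<open>The leading bracket of a node is read in \<open>First\<close> or \<open>After\<close>,
  which decides \<open>\<kappa>\<close>. What is left to process is \<open>tl\<close> of the
  encoding, in state \<open>Open \<kappa>\<close>.\<close>

definition translates :: "sym list \<Rightarrow> bool \<Rightarrow> tform \<Rightarrow> bool" where
  "translates s \<kappa> \<psi> \<longleftrightarrow>
     (\<forall>u. transduce (Open \<kappa>) u s = enc_tform \<psi>) \<and> foldl next_state (Open \<kappa>) s = After"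

lemma translates_leaf: "translates (tl (node 0 [enc_nat p])) \<kappa> (leaf_form \<kappa> p)"
  using length_open_frames[of 0 \<kappa>]
  by (simp add: translates_def node_def transduce_tag transduce_leaf leaf_form_def enc_plug is_binary_def)

lemma translates_unary:
  assumes "translates (tl s) False \<psi>" "s = LB # tl s" "v \<in> {1, 4, 5, 6, 9}"
  shows "translates (tl (node v [s])) \<kappa> (unary_form \<kappa> v \<psi>)"
proof -
  have v: "v \<le> 9" "\<not> is_binary v" "v \<noteq> 0" using assms(3) by (auto simp: is_binary_def)
  have "tl (node v [s]) = enc_nat v @ LB # tl s @ [RB]" using assms(2) by (simp add: node_def)
  then show ?thesis
    using assms(1) v length_open_frames[of v \<kappa>]
    by (simp add: translates_def transduce_tag unary_form_def enc_plug)
qed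

text \<open>The two brackets printed on entering the second child close \<open>arg_frames\<close>;
  the nine at the end close \<open>bin_op\<close> and the eight open frames.\<close>

lemma translates_binary:
  assumes "translates (tl s) False \<psi>" "s = LB # tl s" "translates (tl t) True \<chi>" "t = LB # tl t"
    "v \<in> {2, 3, 7, 8}"
  shows "translates (tl (node v [s, t])) \<kappa> (binary_form \<kappa> v \<psi> \<chi>)"
proof -
  have v: "v \<le> 9" "is_binary v" "v \<noteq> 0" using assms(5) by (auto simp: is_binary_def)
  have "tl (node v [s, t]) = enc_nat v @ LB # tl s @ LB # tl t @ [RB]"
    using assms(2,4) by (simp add: node_def)
  moreover have "enc_tform (bin_op v \<psi>' \<chi>) = bin_prefix v @ enc_tform \<psi>' @ enc_tform \<chi> @ [RB]" for \<psi>'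
    by (simp add: bin_op_def bin_prefix_def node_def)
  ultimately show ?thesis
    using assms(1,3) v length_open_frames[of v \<kappa>]
    by (simp add: translates_def transduce_tag binary_form_def enc_plug length_arg_frames
        numeral_2_eq_2 eval_nat_numeral)
qed

lemma enc_ltl_LB: "enc_ltl \<phi> = LB # tl (enc_ltl \<phi>)"
  by (cases \<phi>) (simp_all add: node_def)

lemma translates_translate: "translates (tl (enc_ltl \<phi>)) \<kappa> (translate \<phi> \<kappa>)"
proof (induction \<phi> arbitrary: \<kappa>)
  case (LProp p)
  show ?case by (simp add: translates_leaf)
qed (simp_all add: translates_unary[OF _ enc_ltl_LB] translates_binary[OF _ enc_ltl_LB _ enc_ltl_LB])

text \<open>In state \<open>After\<close> the bracket closing the instance looks like the end of one
  more node and triggers nine extra brackets. They close nine of the eleven sentence frames; the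
  final \<open>[RB, RB]\<close> of \<open>reduction\<close> closes the others.\<close>

lemma transduce_instance:
  "transduce (Init 0) [] (enc_instance K \<phi>) = enc_tform (translate \<phi> False) @ replicate 9 RB"
proof -
  obtain s where "enc_ltl \<phi> = LB # s" using enc_ltl_LB ..
  then have "enc_instance K \<phi> = (LB # enc_nat 0 @ enc_kripke K) @ LB # tl (enc_ltl \<phi>) @ [RB]"
    by (simp add: enc_instance_def node_def)
  then show ?thesis
    using transduce_kripke translates_translate[of \<phi> False]
    by (simp only: transduce_append) (simp add: translates_def)
qed

lemma reduction_instance:
  "reduction (enc_instance K \<phi>) =
     enc_tform (plug (sentence_frames (enc_instance K \<phi>)) (translate \<phi> False))"
proof -
  have "length (sentence_frames (enc_instance K \<phi>)) = 9 + 2"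
    by (simp add: sentence_frames_def outer_frames_def)
  then show ?thesis
    by (simp only: reduction_eq transduce_instance enc_plug replicate_add) (simp add: numeral_2_eq_2)
qed

section \<open>Correctness of the reduction\<close>

lemma true_sentence_translate:
  "true_in_N (plug (sentence_frames x) (translate \<phi> False)) \<longleftrightarrow>
    (\<exists>R\<subseteq>tuples 2. \<exists>L\<subseteq>tuples 2. \<exists>N r. valid_instance (graph_of x) R L N r \<and>
       tsat \<phi> (traces (kripke_of R L N r)))"
  unfolding true_sentence tsem_translate
  by (simp add: current_team_def child_team_def child_time_def del: ex_tuples_2)

theorem reduction_correct: "x \<in> MC_LTL_tilde \<longleftrightarrow> reduction x \<in> Delta30"
proof
  assume "x \<in> MC_LTL_tilde"
  then obtain K \<phi> where K: "kripke_wf K" "tsat \<phi> (traces K)" and x: "x = enc_instance K \<phi>"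
    by (auto simp: MC_LTL_tilde_def)
  from kripke_of_kripke[OF K(1)] obtain R L where RL: "R \<subseteq> tuples 2" "L \<subseteq> tuples 2"
    "structure_ok R (nworlds K) (root K)" "\<And>w. finite {v. [w, v] \<in> L}"
    "\<And>\<phi>. enc_instance (kripke_of R L (nworlds K) (root K)) \<phi> = enc_instance K \<phi>"
    "traces (kripke_of R L (nworlds K) (root K)) = traces K" by metis
  have "valid_instance (graph_of x) R L (nworlds K) (root K)"
    using RL x by (intro valid_instance_complete) auto
  then have "true_in_N (plug (sentence_frames x) (translate \<phi> False))"
    using RL K(2) unfolding true_sentence_translate by metis
  moreover have "twf (plug (sentence_frames x) (translate \<phi> False))"
    "closed_tform (plug (sentence_frames x) (translate \<phi> False))"
    using child_closed_translate[of False \<phi>]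
    by (auto intro!: sentence_closed simp: child_closed_def child_time_def child_team_def)
  ultimately show "reduction x \<in> Delta30"
    unfolding Delta30_def x reduction_instance by blast
next
  assume "reduction x \<in> Delta30"
  then obtain \<Psi> where \<Psi>: "reduction x = enc_tform \<Psi>" "true_in_N \<Psi>"
    by (auto simp: Delta30_def)
  then have "enc_tform \<Psi> @ [] = frames_prefix (sentence_frames x) @ transduce (Init 0) [] x @ [RB, RB]"
    by (simp add: reduction_eq)
  \<comment> \<open>At this point \<open>x\<close> may still be ill-formed and \<open>\<psi>\<close>
    is unknown; only the printed prefix is used.\<close>
  from enc_eq_frames_prefixD[OF this] obtain \<psi> where \<psi>: "\<Psi> = plug (sentence_frames x) \<psi>" by blast
  from \<Psi>(2) obtain R L N r where RL: "valid_instance (graph_of x) R L N r"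
    and sat: "tsem \<psi> ((\<lambda>_. 0)(10 := N, 11 := r, 0 := 0))
        ((\<lambda>_ _. {})(0 := (\<lambda>_. {})(2 := graph_of x), 1 := (\<lambda>_. {})(2 := R), 2 := (\<lambda>_. {})(2 := L)))
        ((\<lambda>_ _. {})(1 := (\<lambda>_. {})([2] := enc_team (traces (kripke_of R L N r)))))"
    unfolding \<psi> true_sentence by blast
  \<comment> \<open>The witnesses of the true sentence show \<open>x\<close> to be an instance, and
    this in turn identifies \<open>\<psi>\<close>.\<close>
  from valid_instance_sound[OF RL] obtain \<phi> where K: "kripke_wf (kripke_of R L N r)"
    and x: "x = enc_instance (kripke_of R L N r) \<phi>" by blast
  have "enc_tform \<Psi> @ [] = frames_prefix (sentence_frames x) @ enc_tform (translate \<phi> False) @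
      replicate (length (sentence_frames x)) RB"
    using \<Psi>(1) reduction_instance[of "kripke_of R L N r" \<phi>] by (simp add: x[symmetric] enc_plug)
  then have "enc_tform \<psi> = enc_tform (translate \<phi> False)"
    unfolding \<psi> enc_plug by simp
  then have "\<psi> = translate \<phi> False"
    using prefix_codeD[OF prefix_code_enc_tform, of _ "[]" _ "[]"] by simp
  with sat have "tsat \<phi> (traces (kripke_of R L N r))"
    by (simp add: tsem_translate current_team_def child_team_def child_time_def)
  then show "x \<in> MC_LTL_tilde"
    using K x by (auto simp: MC_LTL_tilde_def)
qed

section \<open>Two-way transducers as Turing machines\<close>

type_synonym ('q, 'a, 'b) two_way = "'q \<Rightarrow> 'a cell \<Rightarrow> 'q \<times> int \<times> 'b list"

definition move_head :: "'a list \<Rightarrow> nat \<Rightarrow> int \<Rightarrow> nat" where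
  "move_head x i d = nat (min (int (length x) + 1) (max 0 (int i + d)))"

inductive runs :: "('q, 'a, 'b) two_way \<Rightarrow> 'q \<Rightarrow> 'a list \<Rightarrow> 'q \<Rightarrow> nat \<Rightarrow> 'b list \<Rightarrow> 'q \<Rightarrow> nat \<Rightarrow> bool"
  for step h x where
  runs_refl: "runs step h x q i [] q i"
| runs_step: "q \<noteq> h \<Longrightarrow> step q (input_cell x i) = (q', d, s) \<Longrightarrow>
    runs step h x q' (move_head x i d) out q'' j \<Longrightarrow> runs step h x q i (s @ out) q'' j"

lemma runs_trans:
  "runs step h x q i u q' j \<Longrightarrow> runs step h x q' j v q'' k \<Longrightarrow> runs step h x q i (u @ v) q'' k"
  by (induction rule: runs.induct) (auto intro: runs_step)

text \<open>A Turing machine prints at most one symbol per step, so a control state carries the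
  output still to be printed and the head move that is to follow it.\<close>

fun control_step :: "('q, 'a, 'b) two_way \<Rightarrow> 'q \<times> int \<times> 'b list \<Rightarrow> 'a cell \<Rightarrow>
    ('q \<times> int \<times> 'b list) \<times> int \<times> 'b option" where
  "control_step step (q, d, b # s) c = ((q, d, s), 0, Some b)"
| "control_step step (q, d, []) c =
     (if d \<noteq> 0 then ((q, 0, []), d, None) else (step q c, 0, None))"

text \<open>The machine model fixes 0 as start and 1 as halting state; all other codes are shifted
  by 2 to make room.\<close>

lemma coding_with_endpoints:
  assumes "finite C" "a \<noteq> b"
  obtains code :: "'c \<Rightarrow> nat" and n where "inj_on code C" "code a = 0" "code b = 1" "2 \<le> n"
    "\<forall>k\<in>C. code k < n"
proof -
  obtain h :: "'c \<Rightarrow> nat" where h: "bij_betw h C {0..<card C}"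
    using ex_bij_betw_finite_nat[OF assms(1)] by blast
  define code where "code k = (if k = a then 0 else if k = b then 1 else h k + 2)" for k
  have "inj_on code C"
    using bij_betw_imp_inj_on[OF h] by (auto simp: inj_on_def code_def)
  moreover have "code k < card C + 2" if "k \<in> C" for k
    using bij_betwE[OF h] that by (auto simp: code_def)
  ultimately show ?thesis
    using that[of code "card C + 2"] assms(2) by (auto simp: code_def)
qed

lemma tm_run_workhead_0:
  assumes "\<And>q c g. fst (snd (snd (snd (delta M q c g)))) = 0"
  shows "cfg_workhead (tm_run M x t) = 0"
proof (induction t)
  case 0
  show ?case by (simp add: tm_run_def cfg_workhead_def)
next
  case (Suc t)
  obtain q i w j out where c: "tm_run M x t = (q, i, w, j, out)" by (metis prod_cases5)
  obtain q' g' d1 d2 ob where d: "delta M q (input_cell x i) (w j) = (q', g', d1, d2, ob)"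
    by (metis prod_cases5)
  have "tm_run M x (Suc t) = tm_step M x (tm_run M x t)" by (simp add: tm_run_def)
  moreover have "d2 = 0" using assms[of q "input_cell x i" "w j"] d by simp
  ultimately show ?case using Suc c d by (simp add: tm_step_def cfg_workhead_def)
qed

theorem two_way_logspace_computable:
  fixes step :: "('q, 'a, 'b) two_way"
  assumes fin: "finite Q" "finite (UNIV :: 'a set)" and q0: "q0 \<in> Q" and h: "h \<in> Q" "q0 \<noteq> h"
    and closed: "\<And>q c q' d s. q \<in> Q \<Longrightarrow> step q c = (q', d, s) \<Longrightarrow> q' \<in> Q \<and> d \<in> {-1, 0, 1}"
    and runs: "\<And>x. \<exists>j. runs step h x q0 0 (f x) h j"
  shows "logspace_computable f"
proof -
  have "UNIV = insert LEnd (insert REnd (range (Sym :: 'a \<Rightarrow> _)))"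
    by (auto intro: cell.exhaust)
  then have fin_cell: "finite (UNIV :: 'a cell set)" using fin(2) by (metis finite_imageI finite_insert)
  \<comment> \<open>Pending outputs are suffixes of words printed in a single step, so there are
    finitely many of them.\<close>
  define W where "W = insert [] (\<Union>(q, c)\<in>Q \<times> UNIV.
    (\<lambda>k. drop k (snd (snd (step q c)))) ` {..length (snd (snd (step q c)))})"
  have W_tl: "s \<in> W" if "b # s \<in> W" for b s
  proof -
    from that obtain q c k where q: "q \<in> Q" and k: "b # s = drop k (snd (snd (step q c)))"
      by (auto simp: W_def)
    then have "s = drop (Suc k) (snd (snd (step q c)))" by (metis drop_Suc list.sel(3) tl_drop)
    moreover have "Suc k \<le> length (snd (snd (step q c)))"
      using k by (metis Suc_leI drop_eq_Nil leI list.distinct(1))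
    ultimately show ?thesis using q unfolding W_def by blast
  qed
  have W_step: "s \<in> W" if "q \<in> Q" "step q c = (q', d, s)" for q c q' d s
    using that unfolding W_def by (intro insertI2 UN_I[of "(q, c)"]) (auto intro!: image_eqI[of _ _ 0])
  define C where "C = Q \<times> {-1, 0, 1 :: int} \<times> W"
  have "finite W" unfolding W_def using fin(1) fin_cell by auto
  then have "finite C" unfolding C_def using fin(1) by auto
  moreover have "(q0, 0 :: int, [] :: 'b list) \<noteq> (h, 0, [])" using h by simp
  ultimately obtain code :: "'q \<times> int \<times> 'b list \<Rightarrow> nat" and n where code: "inj_on code C"
    "code (q0, 0, []) = 0" "code (h, 0, []) = 1" "2 \<le> n" "\<forall>k\<in>C. code k < n"
    by (rule coding_with_endpoints)
  have C: "k' \<in> C \<and> d \<in> {-1, 0, 1}" if "k \<in> C" "control_step step k c = (k', d, ob)" for k c k' d ob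
  proof -
    obtain q e s where k: "k = (q, e, s)" by (metis prod_cases3)
    show ?thesis
    proof (cases s)
      case Nil
      show ?thesis
      proof (cases "e = 0")
        case True
        then have s: "step q c = k'" "d = 0" using that k Nil by auto
        obtain q' d' s' where k': "k' = (q', d', s')" by (metis prod_cases3)
        have "q \<in> Q" using that(1) k by (simp add: C_def)
        then show ?thesis using closed[of q c] W_step[of q c] s k' by (auto simp: C_def)
      next
        case False
        then show ?thesis using that k Nil by (auto simp: C_def W_def)
      qed
    next
      case (Cons b s')
      then show ?thesis using that k W_tl by (auto simp: C_def)
    qed
  qed
  \<comment> \<open>Numbers that code no control state receive a halting transition, since
    \<open>tm_valid\<close> constrains every state below \<open>n\<close>. The work alphabet is the
    blank alone.\<close>
  define M :: "('a, 'b) tm" where "M = TM (\<lambda>q c g.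
    if q \<in> code ` C then
      (let (k, d, ob) = control_step step (inv_into C code q) c in (code k, 0, d, 0, ob))
    else (1, 0, 0, 0, None)) n 1"
  have code_lt: "code k' < n" if "k \<in> C" "control_step step k c = (k', d, ob)" for k c k' d ob
    using C[OF that] code(5) by blast
  have "tm_valid M"
    unfolding tm_valid_def M_def
    using code(4,5) by (auto simp: inv_into_f_f[OF code(1)] split: prod.splits dest: C intro: code_lt)
  define cfg :: "'q \<times> int \<times> 'b list \<Rightarrow> nat \<Rightarrow> 'b list \<Rightarrow> 'b config" where
    "cfg k i out = (code k, i, \<lambda>_. 0, 0, out)" for k i out
  have step1: "tm_step M x (cfg k i out) = cfg k' (move_head x i d) (out @ (case ob of None \<Rightarrow> [] | Some b \<Rightarrow> [b]))"
    if "k \<in> C" "k \<noteq> (h, 0, [])" "control_step step k (input_cell x i) = (k', d, ob)" for x k i out k' d ob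
  proof -
    have "(h, 0, []) \<in> C" using h by (auto simp: C_def W_def)
    then have "code k \<noteq> 1" using that(1,2) code(1,3) by (metis inj_onD)
    then show ?thesis
      using that code(1) by (simp add: tm_step_def cfg_def M_def move_head_def fun_eq_iff)
  qed
  define reach where "reach x c c' \<longleftrightarrow> (\<exists>t. (tm_step M x ^^ t) c = c')" for x c c'
  have reach_refl: "reach x c c" for x c
    unfolding reach_def by (rule exI[of _ 0]) simp
  have reach_trans: "reach x c c''" if "reach x c c'" "reach x c' c''" for x c c' c''
  proof -
    from that obtain t u where "(tm_step M x ^^ t) c = c'" "(tm_step M x ^^ u) c' = c''"
      unfolding reach_def by blast
    then have "(tm_step M x ^^ (u + t)) c = c''" by (simp add: funpow_add)
    then show ?thesis unfolding reach_def ..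
  qed
  have reach_step: "reach x c c'" if "tm_step M x c = c'" for x c c'
    unfolding reach_def by (rule exI[of _ "Suc 0"]) (simp add: that)
  have move_0: "move_head x i 0 = i" if "i \<le> length x + 1" for x :: "'a list" and i
    using that by (auto simp: move_head_def)
  have emit: "reach x (cfg (q, d, s) i out) (cfg (q, d, []) i (out @ s))"
    if "(q, d, s) \<in> C" "i \<le> length x + 1" for x q d s i out
    using that(1)
  proof (induction s arbitrary: out)
    case Nil
    show ?case using reach_refl by simp
  next
    case (Cons b s)
    have "tm_step M x (cfg (q, d, b # s) i out) = cfg (q, d, s) i (out @ [b])"
      using step1[OF Cons.prems, of x i "(q, d, s)" 0 "Some b" out] move_0[OF that(2)] by simp
    moreover have "(q, d, s) \<in> C" using Cons.prems W_tl by (auto simp: C_def)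
    ultimately show ?case
      using reach_trans[OF reach_step Cons.IH[of "out @ [b]"]] by simp
  qed
  have move: "reach x (cfg (q, d, []) i out) (cfg (q, 0, []) (move_head x i d) out)"
    if "(q, d, []) \<in> C" "i \<le> length x + 1" for x q d i out
  proof (cases "d = 0")
    case True
    then show ?thesis using move_0[OF that(2)] reach_refl by simp
  next
    case False
    then show ?thesis
      using step1[OF that(1), of x i "(q, 0, [])" d None out] by (intro reach_step) simp
  qed
  have sim: "reach x (cfg (q, 0, []) i out) (cfg (q', 0, []) j (out @ u))"
    if "runs step h x q i u q' j" "q \<in> Q" "i \<le> length x + 1" for x q i u q' j out
    using that
  proof (induction arbitrary: out rule: runs.induct)
    case (runs_refl q i)
    show ?case using reach_refl by simp
  next
    case (runs_step q i q' d s u q'' j)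
    have q: "(q, 0, []) \<in> C" using runs_step.prems by (auto simp: C_def W_def)
    have q': "(q', d, s) \<in> C" "(q', d, []) \<in> C" "q' \<in> Q"
      using closed[OF runs_step.prems(1) runs_step.hyps(2)] W_step[OF runs_step.prems(1) runs_step.hyps(2)]
      by (auto simp: C_def W_def)
    have i': "move_head x i d \<le> length x + 1" by (auto simp: move_head_def)
    have "tm_step M x (cfg (q, 0, []) i out) = cfg (q', d, s) i out"
      using step1[OF q, of x i "(q', d, s)" 0 None out] runs_step.hyps(1,2) move_0[OF runs_step.prems(2)]
      by simp
    from reach_trans[OF reach_step[OF this] reach_trans[OF emit[OF q'(1) runs_step.prems(2)]
        reach_trans[OF move[OF q'(2) runs_step.prems(2)] runs_step.IH[OF q'(3) i']]]]
    show ?case by simp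
  qed
  have wh: "cfg_workhead (tm_run M x t) = 0" for x t
    by (rule tm_run_workhead_0) (simp add: M_def split: prod.splits)
  show ?thesis
    unfolding logspace_computable_def
  \<comment> \<open>The space constant is 0: the work head never leaves its first cell.\<close>
  proof (rule exI[of _ M], rule exI[of _ 0], intro conjI allI \<open>tm_valid M\<close>)
    fix x
    obtain j where "runs step h x q0 0 (f x) h j" using runs by blast
    from sim[OF this q0, of "[]"] obtain t
      where "(tm_step M x ^^ t) (cfg (q0, 0, []) 0 []) = cfg (h, 0, []) j (f x)"
      by (auto simp: reach_def)
    then have "tm_run M x t = (1, j, \<lambda>_. 0, 0, f x)"
      by (simp add: tm_run_def cfg_def code)
    then show "\<exists>t. cfg_state (tm_run M x t) = 1 \<and> cfg_output (tm_run M x t) = f x \<and>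
        (\<forall>s\<le>t. real (cfg_workhead (tm_run M x s)) \<le> 0 * log 2 (real (length x) + 2))"
      by (intro exI[of _ t]) (simp add: cfg_state_def cfg_output_def wh)
  qed
qed

section \<open>A transducer for the reduction\<close>

text \<open>\<open>emit\<close> consults the word already read only at the end of a proposition.
  That case becomes an excursion through \<open>LeafBack\<close> and \<open>LeafForward\<close>, so
  elsewhere the empty history can be passed.\<close>

fun reduction_step :: "(state, sym, sym) two_way" where
  "reduction_step Start c =
     (WordForward, 1, frames_prefix [FEx2 0 2] @ LB # enc_nat 5 @ frames_prefix word_start)"
| "reduction_step WordForward (Sym c) = (WordForward, 1, frames_prefix (word_block c))"
| "reduction_step WordForward REnd = (WordBackward, -1, enc_tform word_end)"
| "reduction_step WordBackward (Sym c) = (WordBackward, -1, replicate 5 RB)"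
| "reduction_step WordBackward LEnd = (Init 0, 1, [RB, RB] @ frames_prefix outer_frames)"
| "reduction_step LeafBits (Sym RB) = (LeafBack, -1, enc_tform prop_form)"
| "reduction_step LeafBack (Sym c) =
     (if is_bit c then (LeafBack, -1, replicate 4 RB) else (LeafForward, 1, []))"
| "reduction_step LeafBack LEnd = (LeafForward, 1, [])"
| "reduction_step LeafForward (Sym c) = (if c = RB then After else LeafForward, 1, [])"
| "reduction_step q (Sym c) = (next_state q c, 1, emit q [] c)"
| "reduction_step q _ = (Halt, 0, [RB, RB])"

section \<open>Runs of the transducer\<close>

lemma input_cell_append:
  "input_cell (u @ c # v) (Suc (length u)) = Sym c"
  "input_cell x (Suc (length x)) = REnd"
  "input_cell x 0 = LEnd"
  by (auto simp: input_cell_def nth_append)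

lemma move_head_simps:
  "i \<le> length x \<Longrightarrow> move_head x i 1 = Suc i"
  "i \<le> length x \<Longrightarrow> move_head x (Suc i) (-1) = i"
  "move_head x (Suc (length x)) 0 = Suc (length x)"
  by (auto simp: move_head_def)

abbreviation reduction_runs where
  "reduction_runs \<equiv> runs reduction_step Halt"

lemma runs_forward:
  "reduction_runs (u @ v) WordForward (Suc (length u))
     (concat (map (\<lambda>c. frames_prefix (word_block c)) v)) WordForward (Suc (length (u @ v)))"
proof (induction v arbitrary: u)
  case Nil
  show ?case by (simp add: runs_refl)
next
  case (Cons c v)
  show ?case
    using Cons.IH[of "u @ [c]"]
    by (auto simp: input_cell_append move_head_simps intro!: runs_step)
qed

lemma runs_backward:
  "reduction_runs (u @ v) WordBackward (length u)
     (concat (map (\<lambda>_. replicate 5 RB) (rev u))) WordBackward 0"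
proof (induction u arbitrary: v rule: rev_induct)
  case Nil
  show ?case by (simp add: runs_refl)
next
  case (snoc c u)
  show ?case
    using snoc.IH[of "c # v"] input_cell_append(1)[of u c v]
    by (auto simp: move_head_simps intro!: runs_step)
qed

text \<open>The left end marker acts like a non-digit, so no assumption on the part already read is
  required.\<close>

lemma runs_leaf_back:
  "reduction_runs (u @ c # v) LeafBack (length u)
     (concat (map (\<lambda>_. replicate 4 RB) (takeWhile is_bit (rev u)))) LeafForward
     (Suc (length u - length (takeWhile is_bit (rev u))))"
proof (induction u arbitrary: c v rule: rev_induct)
  case Nil
  have "reduction_runs (c # v) LeafBack 0 ([] @ []) LeafForward (Suc 0)"
    by (rule runs_step[of LeafBack]) (auto simp: input_cell_append move_head_simps intro: runs_refl)
  then show ?case by simp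
next
  case (snoc a u)
  show ?case
  proof (cases "is_bit a")
    case True
    then show ?thesis
      using snoc.IH[of a "c # v"] input_cell_append(1)[of u a "c # v"]
      by (auto simp: move_head_simps intro!: runs_step)
  next
    case False
    have "reduction_runs (u @ a # c # v) LeafBack (Suc (length u)) ([] @ []) LeafForward (Suc (Suc (length u)))"
      by (rule runs_step[of LeafBack])
        (auto simp: False input_cell_append move_head_simps intro: runs_refl)
    then show ?thesis using False by simp
  qed
qed

lemma runs_leaf_forward:
  "(\<forall>c\<in>set b. is_bit c) \<Longrightarrow>
   reduction_runs (u @ b @ RB # v) LeafForward (Suc (length u)) [] After (Suc (Suc (length u + length b)))"
proof (induction b arbitrary: u)
  case Nil
  have "reduction_runs (u @ RB # v) LeafForward (Suc (length u)) ([] @ []) After (Suc (Suc (length u)))"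
    by (rule runs_step[of LeafForward])
      (auto simp: input_cell_append move_head_simps intro: runs_refl)
  then show ?case by simp
next
  case (Cons c b)
  have "reduction_runs (u @ c # b @ RB # v) LeafForward (Suc (length u)) ([] @ []) After
      (Suc (Suc (Suc (length u + length b))))"
    using Cons.IH[of "u @ [c]"] Cons.prems
    by (intro runs_step[of LeafForward _ _ _ _ LeafForward 1])
      (auto simp: input_cell_append move_head_simps is_bit_def)
  then show ?case by simp
qed

text \<open>The head goes back over the digits, printing four brackets for each, and silently
  returns past the same \<open>RB\<close>. It ends where a one-way pass would be.\<close>

lemma runs_leaf:
  "reduction_runs (rev u @ RB # v) LeafBits (Suc (length u)) (emit LeafBits u RB) After (Suc (Suc (length u)))"
proof -
  let ?b = "takeWhile is_bit u" and ?r = "dropWhile is_bit u"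
  have "rev u = rev ?r @ rev ?b" by (simp flip: rev_append)
  then have u: "rev u @ RB # v = rev ?r @ rev ?b @ RB # v" by (metis append_assoc)
  have l: "length u = length ?r + length ?b" by (metis add.commute length_append takeWhile_dropWhile_id)
  have "reduction_runs (rev u @ RB # v) LeafBack (length u)
      (concat (map (\<lambda>_. replicate 4 RB) ?b)) LeafForward (Suc (length ?r))"
    using runs_leaf_back[of "rev u" RB v] l by simp
  moreover have "reduction_runs (rev u @ RB # v) LeafForward (Suc (length ?r)) [] After (Suc (Suc (length u)))"
    unfolding u using runs_leaf_forward[of "rev ?b" "rev ?r" v] l by (auto dest: set_takeWhileD)
  ultimately have "reduction_runs (rev u @ RB # v) LeafBack (length u)
      (concat (map (\<lambda>_. replicate 4 RB) ?b) @ []) After (Suc (Suc (length u)))"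
    by (rule runs_trans)
  then show ?thesis
    using input_cell_append(1)[of "rev u" RB v]
    by (auto simp: move_head_simps intro!: runs_step)
qed

definition one_way_states :: "state set" where
  "one_way_states = - {Start, WordForward, WordBackward, LeafBack, LeafForward, Halt}"

lemma next_state_one_way: "q \<in> one_way_states \<Longrightarrow> next_state q c \<in> one_way_states"
  by (cases q; cases c) (auto simp: one_way_states_def)

lemma reduction_step_one_way:
  assumes "q \<in> one_way_states"
  shows "\<not> (q = LeafBits \<and> c = RB) \<Longrightarrow> reduction_step q (Sym c) = (next_state q c, 1, emit q u c)"
    and "reduction_step q REnd = (Halt, 0, [RB, RB])"
  using assms by (cases q; cases c; simp add: one_way_states_def)+

lemma runs_transduce:
  "q \<in> one_way_states \<Longrightarrow> reduction_runs (rev u @ v) q (Suc (length u)) (transduce q u v)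
     (foldl next_state q v) (Suc (length (rev u @ v)))"
proof (induction v arbitrary: q u)
  case Nil
  show ?case by (simp add: runs_refl)
next
  case (Cons c v)
  from Cons.IH[OF next_state_one_way[OF Cons.prems, of c], of "c # u"]
  have IH: "reduction_runs (rev u @ c # v) (next_state q c) (Suc (Suc (length u)))
      (transduce (next_state q c) (c # u) v) (foldl next_state q (c # v)) (Suc (length (rev u @ c # v)))"
    by simp
  have "reduction_runs (rev u @ c # v) q (Suc (length u)) (emit q u c @ transduce (next_state q c) (c # u) v)
      (foldl next_state q (c # v)) (Suc (length (rev u @ c # v)))"
  proof (cases "q = LeafBits \<and> c = RB")
    case True
    then show ?thesis using runs_trans[OF runs_leaf[of u v]] IH by simp
  next
    case False
    have "q \<noteq> Halt" using Cons.prems by (auto simp: one_way_states_def)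
    then show ?thesis
      using reduction_step_one_way(1)[OF Cons.prems False] IH input_cell_append(1)[of "rev u" c v]
        move_head_simps(1)[of "Suc (length u)" "rev u @ c # v"]
      by (intro runs_step[of q _ _ _ _ "next_state q c" 1]) simp_all
  qed
  then show ?case by simp
qed

lemma runs_reduction: "reduction_runs x Start 0 (reduction x) Halt (Suc (length x))"
proof -
  have 1: "reduction_runs x Start 0
      ((frames_prefix [FEx2 0 2] @ LB # enc_nat 5 @ frames_prefix word_start) @ []) WordForward (Suc 0)"
    by (rule runs_step[of Start]) (auto simp: move_head_simps intro: runs_refl)
  have 2: "reduction_runs x WordForward (Suc 0)
      (concat (map (\<lambda>c. frames_prefix (word_block c)) x)) WordForward (Suc (length x))"
    using runs_forward[of "[]" x] by simp
  have 3: "reduction_runs x WordForward (Suc (length x)) (enc_tform word_end @ []) WordBackward (length x)"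
    by (rule runs_step[of WordForward])
      (auto simp: input_cell_append move_head_simps intro: runs_refl)
  have 4: "reduction_runs x WordBackward (length x)
      (concat (map (\<lambda>_. replicate 5 RB) (rev x))) WordBackward 0"
    using runs_backward[of x "[]"] by simp
  have 5: "reduction_runs x WordBackward 0 (([RB, RB] @ frames_prefix outer_frames) @ []) (Init 0) (Suc 0)"
    by (rule runs_step[of WordBackward])
      (auto simp: input_cell_append move_head_simps intro: runs_refl)
  have init: "Init 0 \<in> one_way_states" by (simp add: one_way_states_def)
  have 6: "reduction_runs x (Init 0) (Suc 0) (transduce (Init 0) [] x)
      (foldl next_state (Init 0) x) (Suc (length x))"
    using runs_transduce[OF init, of "[]" x] by simp
  \<comment> \<open>On ill-formed words, too, the sweep ends in a one-way state, where the right end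
    marker leads to \<open>Halt\<close>.\<close>
  have last: "foldl next_state (Init 0) x \<in> one_way_states"
    by (induction x rule: rev_induct) (auto simp: init next_state_one_way)
  then have "foldl next_state (Init 0) x \<noteq> Halt" by (auto simp: one_way_states_def)
  then have 7: "reduction_runs x (foldl next_state (Init 0) x) (Suc (length x)) ([RB, RB] @ []) Halt (Suc (length x))"
    by (rule runs_step)
      (auto simp: input_cell_append reduction_step_one_way[OF last] move_head_simps intro: runs_refl)
  show ?thesis
    using runs_trans[OF 1 runs_trans[OF 2 runs_trans[OF 3 runs_trans[OF 4 runs_trans[OF 5
      runs_trans[OF 6 7]]]]]]
    by (simp add: reduction_def)
qed

text \<open>The type \<open>state\<close> is infinite because of its counters; saturation confines
  the machine to this finite part.\<close>

definition state_set :: "state set" where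
  "state_set = {q. case q of Init n \<Rightarrow> n \<le> 3 | Skip d \<Rightarrow> d \<le> 5 | Tag \<kappa> v \<Rightarrow> v \<le> 9 | _ \<Rightarrow> True}"

lemma finite_state_set: "finite state_set"
proof (rule finite_subset)
  let ?S = "{Start, WordForward, WordBackward, First, LeafOpen, LeafBits, LeafBack, LeafForward,
     After, Halt} \<union> range Open \<union> Init ` {..3} \<union> Skip ` {..5} \<union> case_prod Tag ` (UNIV \<times> {..9})"
  show "state_set \<subseteq> ?S"
  proof
    fix q
    assume "q \<in> state_set"
    then show "q \<in> ?S" by (cases q) (auto simp: state_set_def)
  qed
  show "finite ?S" by simp
qed

lemma next_state_set: "q \<in> state_set \<Longrightarrow> next_state q c \<in> state_set"
  by (cases q; cases c) (auto simp: state_set_def)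

lemma reduction_step_set:
  assumes "q \<in> state_set" "reduction_step q c = (q', d, s)"
  shows "q' \<in> state_set \<and> d \<in> {-1, 0, 1}"
proof -
  have basic: "{Start, WordForward, WordBackward, First, LeafOpen, LeafBits, LeafBack, LeafForward,
     After, Halt, Init 0} \<subseteq> state_set" by (auto simp: state_set_def)
  then show ?thesis
    using assms next_state_set[OF assms(1)]
    by (cases "(q, c)" rule: reduction_step.cases) (auto split: if_splits)
qed

theorem logspace_computable_reduction: "logspace_computable reduction"
proof (rule two_way_logspace_computable)
  show "finite state_set" by (rule finite_state_set)
  have "(UNIV :: sym set) \<subseteq> {B0, B1, LB, RB}" by (auto intro: sym.exhaust)
  then show "finite (UNIV :: sym set)" by (rule finite_subset) simp
  show "Start \<in> state_set" "Halt \<in> state_set" by (auto simp: state_set_def)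
  show "Start \<noteq> Halt" by simp
  show "q' \<in> state_set \<and> d \<in> {-1, 0, 1}" if "q \<in> state_set" "reduction_step q c = (q', d, s)" for q c q' d s
    using reduction_step_set[OF that] .
  show "\<exists>j. reduction_runs x Start 0 (reduction x) Halt j" for x
    using runs_reduction by blast
qed

theorem mainTheorem11:
  shows "logspace_reducible MC_LTL_tilde Delta30"
  unfolding logspace_reducible_def
  using logspace_computable_reduction reduction_correct by blast

end
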